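(* Consider the model predictive control (MPC) problem with reconfigurable ellipsoidal terminal set: given the data in the context, minimize over $\boldsymbol{u}=(u_0,\dots,u_{N-1})$, $\boldsymbol{x}=(x_0,\dots,x_N)$, $c\in\mathbb{R}^{n_x}$ and $r>0$ the objective $$\sum_{k=0}^{N-1}l(x_k,u_k)+\psi(x_N)$$ subject to $x_0=x_{\rm init}$; $x_{k+1}=Ax_k+Bu_k$ for $k=0,\dots,N-1$; $x_k\in\mathcal{X}$ for $k=1,\dots,N-1$; $u_k\in\mathcal{U}$ for $k=0,\dots,N-1$; $x_N\in\mathcal{T}$, where $\mathcal{T}=\{x\in\mathbb{R}^{n_x}\mid (x-c)^TP(x-c)\le r^2\}$; and $$A_{\rm cl}x\in\mathcal{T},\qquad x\in\mathcal{X},\qquad Kx\in\mathcal{U}\qquad\text{for all }x\in\mathcal{T}.$$ Let $S\in\mathbb{R}^{n_x\times n_x}$ be a nonsingular matrix with $S^TPS=\operatorname{diag}(\pi_1,\dots,\pi_{n_x})$ and $S^TA_{\rm cl}^TPA_{\rm cl}S=\operatorname{diag}(\alpha_1,\dots,\alpha_{n_x})$, and let $M=(A_{\rm cl}-I)^TP(A_{\rm cl}-I)$. Then this problem is equivalent to minimizing the same objective over $(\boldsymbol{u},\boldsymbol{x},c,r,\hat\lambda,\hat t)$ with $r>0$, $\hat\lambda\in\mathbb{R}$, $\hat t\in\mathbb{R}^{n_x}$, subject to $$\begin{array}{l} x_0=x_{\rm init},\\ x_{k+1}=Ax_k+Bu_k,\quad k=0,\dots,N-1,\\ Ex_k\le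 f,\quad k=1,\dots,N-1,\\ Gu_k\le h,\quad k=0,\dots,N-1,\\ \|P^{1/2}(x_N-c)\|_2\le r,\\ \big\|\big(2M^{1/2}c,\ \boldsymbol{1}^T\hat t+\hat\lambda\big)\big\|_2\le 2r-\boldsymbol{1}^T\hat t-\hat\lambda,\\ \big([S^TA_{\rm cl}^TP(A_{\rm cl}-I)c]_i,\ \hat t_i,\ \hat\lambda\pi_i-r\alpha_i\big)\in\mathcal{Q},\quad i=1,\dots,n_x,\\ e_j^Tc+\|\hat e_j\|_2\,r\le f_j,\quad j=1,\dots,n,\\ g_j^Tc+\|\hat g_j\|_2\,r\le h_j,\quad j=1,\dots,m, \end{array}$$ where $e_j^T,\hat e_j^T,g_j^T,\hat g_j^T$ are the $j$-th rows of $E$, $EP^{-1/2}$, $GK$, $GKP^{-1/2}$, respectively. Equivalence means: $(\boldsymbol{u},\boldsymbol{x},c,r)$ is feasible for the first problem if and only if there exists $(\hat\lambda,\hat t)$ such that $(\boldsymbol{u},\boldsymbol{x},c,r,\hat\lambda,\hat t)$ is feasible for the second. In particular, if $l$ and $\psi$ are convex quadratic functions, then, apart from the strict bound $r>0$, the second problem has only linear and second-order cone constraints and a convex quadratic objective, so it can be represented as a second-order cone program.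
   Context: Data: a linear time-invariant system $x_{k+1}=Ax_k+Bu_k$ with $A\in\mathbb{R}^{n_x\times n_x}$, $B\in\mathbb{R}^{n_x\times n_u}$; horizon $N\ge1$; polyhedral state and input constraint sets $\mathcal{X}=\{x\in\mathbb{R}^{n_x}\mid Ex\le f\}$, $\mathcal{U}=\{u\in\mathbb{R}^{n_u}\mid Gu\le h\}$ with $E\in\mathbb{R}^{n\times n_x}$, $f\in\mathbb{R}^n$, $G\in\mathbb{R}^{m\times n_u}$, $h\in\mathbb{R}^m$; a symmetric positive definite matrix $P\in\mathbb{R}^{n_x\times n_x}$; an initial state $x_{\rm init}\in\mathcal{X}$; a stage cost $l:\mathcal{X}\times\mathcal{U}\to\mathbb{R}$ and a terminal cost $\psi:\mathcal{X}\to\mathbb{R}$. $K\in\mathbb{R}^{n_u\times n_x}$ is a linear terminal feedback gain such that $A_{\rm cl}=A+BK$ is stable (the discrete-time system $x_{k+1}=A_{\rm cl}x_k$ is asymptotically stable). The centre $c$ and scaling $r>0$ of the terminal set $\mathcal{T}$ are decision variables. $P^{1/2}$ and $M^{1/2}$ are symmetric positive semidefinite square roots. Vector inequalities are componentwise, $\boldsymbol{1}$ is the all-ones vector, $[v]_i$ the $i$-th component of $v$, and $\mathcal{Q}=\{(x,y,z)\in\mathbb{R}^3\mid\|(2x,\,y-z)\|_2\le y+z\}$. A second-order cone program is a problem of minimizing a linear function subject to finitely many constraints $\|A_ix+b_i\|_2\le c_i^Tx+d_i$ and $Fx=g$. *)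

theory Defs
  imports "HOL-Analysis.Analysis"
begin

section \<open>Matrices and constraint sets\<close>

definition pos_def :: "real^'n^'n \<Rightarrow> bool" where
  "pos_def P \<longleftrightarrow> transpose P = P \<and> (\<forall>x. x \<noteq> 0 \<longrightarrow> x \<bullet> (P *v x) > 0)"

definition pos_semidef :: "real^'n^'n \<Rightarrow> bool" where
  "pos_semidef P \<longleftrightarrow> transpose P = P \<and> (\<forall>x. x \<bullet> (P *v x) \<ge> 0)"

definition is_psd_sqrt :: "real^'n^'n \<Rightarrow> real^'n^'n \<Rightarrow> bool" where
  "is_psd_sqrt R Q \<longleftrightarrow> pos_semidef R \<and> R ** R = Q"

definition diag_matrix :: "real^'n \<Rightarrow> real^'n^'n" where
  "diag_matrix d = (\<chi> i j. if i = j then d $ i else 0)"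

text \<open>Asymptotic stability of the origin for \<open>x\<^sub>k\<^sub>+\<^sub>1 = A x\<^sub>k\<close>:
  Lyapunov stability together with local attractivity.\<close>

definition asymptotically_stable :: "real^'n^'n \<Rightarrow> bool" where
  "asymptotically_stable A \<longleftrightarrow>
     (\<forall>\<epsilon>>0. \<exists>\<delta>>0. \<forall>x0. norm x0 < \<delta> \<longrightarrow> (\<forall>k. norm (((*v) A ^^ k) x0) < \<epsilon>)) \<and>
     (\<exists>\<delta>>0. \<forall>x0. norm x0 < \<delta> \<longrightarrow> (\<lambda>k. ((*v) A ^^ k) x0) \<longlonglongrightarrow> 0)"

definition halfspaces :: "real^'d^'n \<Rightarrow> real^'n \<Rightarrow> (real^'d) set" where
  "halfspaces E f = {x. E *v x \<le> f}"

definition terminal_set :: "real^'d^'d \<Rightarrow> real^'d \<Rightarrow> real \<Rightarrow> (real^'d) set" where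
  "terminal_set P c r = {x. (x - c) \<bullet> (P *v (x - c)) \<le> r\<^sup>2}"

definition qcone :: "(real \<times> real \<times> real) set" where
  "qcone = {(x, y, z). norm (2 * x, y - z) \<le> y + z}"


section \<open>The two optimization problems\<close>

text \<open>A trajectory is a function on \<open>nat\<close>; only \<open>u k\<close> with \<open>k < N\<close> and \<open>x k\<close> with
  \<open>k \<le> N\<close> occur below.  Costs are total functions of which only the values on
  the constraint sets are relevant.\<close>

definition mpc_cost ::
  "nat \<Rightarrow> ((real^'x) \<times> (real^'u) \<Rightarrow> real) \<Rightarrow> (real^'x \<Rightarrow> real)
    \<Rightarrow> (nat \<Rightarrow> real^'u) \<Rightarrow> (nat \<Rightarrow> real^'x) \<Rightarrow> real" where
  "mpc_cost N l \<psi> u x = (\<Sum>k<N. l (x k, u k)) + \<psi> (x N)"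

definition mpc_feasible where
  "mpc_feasible N (A :: real^'x^'x) (B :: real^'u^'x) (K :: real^'x^'u)
      (E :: real^'x^'n) f (G :: real^'u^'m) h P x_init u x c r \<longleftrightarrow>
     r > 0 \<and>
     x 0 = x_init \<and>
     (\<forall>k<N. x (Suc k) = A *v x k + B *v u k) \<and>
     (\<forall>k\<in>{1..<N}. x k \<in> halfspaces E f) \<and>
     (\<forall>k<N. u k \<in> halfspaces G h) \<and>
     x N \<in> terminal_set P c r \<and>
     (\<forall>y\<in>terminal_set P c r.
        (A + B ** K) *v y \<in> terminal_set P c r \<and>
        y \<in> halfspaces E f \<and>
        K *v y \<in> halfspaces G h)"

text \<open>All constraints of the reformulated problem except \<open>r > 0\<close>.  The arguments
  \<open>Ph\<close> and \<open>Mh\<close> stand for the square roots of \<open>P\<close> and \<open>M\<close>, and \<open>\<pi>\<close>, \<open>\<alpha>\<close> for the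
  diagonals obtained from \<open>S\<close>.\<close>

definition conic_constraints where
  "conic_constraints N (A :: real^'x^'x) (B :: real^'u^'x) (K :: real^'x^'u)
      (E :: real^'x^'n) f (G :: real^'u^'m) h P Ph Mh S \<pi> \<alpha> x_init u x c r lam t \<longleftrightarrow>
     x 0 = x_init \<and>
     (\<forall>k<N. x (Suc k) = A *v x k + B *v u k) \<and>
     (\<forall>k\<in>{1..<N}. E *v x k \<le> f) \<and>
     (\<forall>k<N. G *v u k \<le> h) \<and>
     norm (Ph *v (x N - c)) \<le> r \<and>
     norm (2 *\<^sub>R (Mh *v c), (\<Sum>i\<in>UNIV. t $ i) + lam) \<le> 2 * r - (\<Sum>i\<in>UNIV. t $ i) - lam \<and>
     (\<forall>i. ((transpose S ** transpose (A + B ** K) ** P ** (A + B ** K - mat 1) *v c) $ i,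
           t $ i, lam * \<pi> $ i - r * \<alpha> $ i) \<in> qcone) \<and>
     (\<forall>j. row j E \<bullet> c + norm (row j (E ** matrix_inv Ph)) * r \<le> f $ j) \<and>
     (\<forall>j. row j (G ** K) \<bullet> c + norm (row j (G ** K ** matrix_inv Ph)) * r \<le> h $ j)"

definition conic_feasible where
  "conic_feasible N A B K E f G h P Ph Mh S \<pi> \<alpha> x_init u x c r lam t \<longleftrightarrow>
     r > 0 \<and> conic_constraints N A B K E f G h P Ph Mh S \<pi> \<alpha> x_init u x c r lam t"


section \<open>Convex quadratic functions\<close>

definition convex_quadratic_on :: "'a::euclidean_space set \<Rightarrow> ('a \<Rightarrow> real) \<Rightarrow> bool" where
  "convex_quadratic_on D \<phi> \<longleftrightarrow> convex_on D \<phi> \<and>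
     (\<exists>Q q q0. linear Q \<and> (\<forall>z\<in>D. \<phi> z = z \<bullet> Q z + q \<bullet> z + q0))"

text \<open>The dimension of the decision vector depends on the number \<open>N\<close>, so decision vectors
  are functions \<open>z\<close> on a type of coordinate names of which only the coordinates in a finite
  set \<open>V\<close> count.  The next definition is the previous one for the space \<open>\<real>\<^sup>V\<close>.\<close>

definition coord_convex_quadratic_on ::
  "'v set \<Rightarrow> ('v \<Rightarrow> real) set \<Rightarrow> (('v \<Rightarrow> real) \<Rightarrow> real) \<Rightarrow> bool" where
  "coord_convex_quadratic_on V D \<phi> \<longleftrightarrow>
     (\<forall>y\<in>D. \<forall>z\<in>D. \<forall>s\<in>{0..1}.
        (\<lambda>v. (1 - s) * y v + s * z v) \<in> D \<and>
        \<phi> (\<lambda>v. (1 - s) * y v + s * z v) \<le> (1 - s) * \<phi> y + s * \<phi> z) \<and>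
     (\<exists>Q q q0. \<forall>z\<in>D.
        \<phi> z = (\<Sum>v\<in>V. \<Sum>w\<in>V. Q v w * z v * z w) + (\<Sum>v\<in>V. q v * z v) + q0)"


section \<open>Second-order cone programs\<close>

definition lin_form :: "'v set \<Rightarrow> ('v \<Rightarrow> real) \<Rightarrow> ('v \<Rightarrow> real) \<Rightarrow> real" where
  "lin_form V a z = (\<Sum>v\<in>V. a v * z v)"

text \<open>\<open>soc_rows\<close> lists the rows of \<open>A\<^sub>i\<close>, each with its entry of \<open>b\<^sub>i\<close>.  With no rows at all
  the constraint is the linear inequality \<open>0 \<le> c\<^sub>i\<^sup>T z + d\<^sub>i\<close>.\<close>

record 'v soc_constraint =
  soc_rows :: "(('v \<Rightarrow> real) \<times> real) list"
  soc_c :: "'v \<Rightarrow> real"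
  soc_d :: real

definition soc_sat :: "'v set \<Rightarrow> 'v soc_constraint \<Rightarrow> ('v \<Rightarrow> real) \<Rightarrow> bool" where
  "soc_sat V C z \<longleftrightarrow>
     L2_set (\<lambda>i. lin_form V (fst (soc_rows C ! i)) z + snd (soc_rows C ! i))
       {..<length (soc_rows C)}
     \<le> lin_form V (soc_c C) z + soc_d C"

text \<open>\<open>eqs\<close> lists the rows of \<open>F\<close>, each with its entry of \<open>g\<close>.\<close>

record 'v socp =
  objective :: "'v \<Rightarrow> real"
  cones :: "'v soc_constraint list"
  eqs :: "(('v \<Rightarrow> real) \<times> real) list"

definition socp_feasible :: "'v set \<Rightarrow> 'v socp \<Rightarrow> ('v \<Rightarrow> real) \<Rightarrow> bool" where
  "socp_feasible V p z \<longleftrightarrow>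
     (\<forall>C\<in>set (cones p). soc_sat V C z) \<and> (\<forall>(a, b)\<in>set (eqs p). lin_form V a z = b)"

definition soc_describable :: "'v set \<Rightarrow> (('v \<Rightarrow> real) \<Rightarrow> bool) \<Rightarrow> bool" where
  "soc_describable V feas \<longleftrightarrow> finite V \<and> (\<exists>p. \<forall>z. feas z \<longleftrightarrow> socp_feasible V p z)"

text \<open>Minimizing \<open>\<phi>\<close> over \<open>feas\<close> is represented by a program in the original coordinates \<open>V\<close>
  and finitely many auxiliary ones \<open>W\<close> if partial minimization of the program over the
  auxiliary coordinates yields the epigraph of \<open>\<phi>\<close> on \<open>feas\<close>.\<close>

definition socp_representable ::
  "'v set \<Rightarrow> (('v \<Rightarrow> real) \<Rightarrow> bool) \<Rightarrow> (('v \<Rightarrow> real) \<Rightarrow> real) \<Rightarrow> bool" where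
  "socp_representable V feas \<phi> \<longleftrightarrow> finite V \<and>
     (\<exists>(W :: nat set) (p :: ('v + nat) socp). finite W \<and>
        (\<forall>z \<tau>. feas z \<and> \<phi> z \<le> \<tau> \<longleftrightarrow>
           (\<exists>w. socp_feasible (V <+> W) p (case_sum z w) \<and>
                lin_form (V <+> W) (objective p) (case_sum z w) \<le> \<tau>)))"


section \<open>Coordinates of the reformulated problem\<close>

datatype ('x, 'u) mpc_var =
  U_var nat 'u | X_var nat 'x | C_var 'x | R_var | Lam_var | T_var 'x

definition mpc_vars :: "nat \<Rightarrow> ('x, 'u) mpc_var set" where
  "mpc_vars N =
     {U_var k i | k i. k < N} \<union> {X_var k i | k i. k \<le> N} \<union> range C_var \<union> {R_var, Lam_var}
     \<union> range T_var"

definition u_of :: "(('x, 'u) mpc_var \<Rightarrow> real) \<Rightarrow> nat \<Rightarrow> real^'u" where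
  "u_of z k = (\<chi> i. z (U_var k i))"

definition x_of :: "(('x, 'u) mpc_var \<Rightarrow> real) \<Rightarrow> nat \<Rightarrow> real^'x" where
  "x_of z k = (\<chi> i. z (X_var k i))"

definition c_of :: "(('x, 'u) mpc_var \<Rightarrow> real) \<Rightarrow> real^'x" where
  "c_of z = (\<chi> i. z (C_var i))"

definition t_of :: "(('x, 'u) mpc_var \<Rightarrow> real) \<Rightarrow> real^'x" where
  "t_of z = (\<chi> i. z (T_var i))"

end

theory Submission imports Defs begin

text \<open>
  The equivalence of the two problems is a statement about the ellipsoid \<open>\<T>\<close>.  Writing its points as
  \<open>c + r S v\<close> diagonalizes both \<open>P\<close> and \<open>A\<^sub>c\<^sub>l\<^sup>T P A\<^sub>c\<^sub>l\<close>, so that invariance of \<open>\<T>\<close> under \<open>A\<^sub>c\<^sub>l\<close> becomes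
  an upper bound for the separable quadratic \<open>\<Sum>\<^sub>i r \<alpha>\<^sub>i v\<^sub>i\<^sup>2 + 2 b\<^sub>i v\<^sub>i\<close> on the ellipsoid \<open>\<Sum>\<^sub>i \<pi>\<^sub>i v\<^sub>i\<^sup>2 \<le> 1\<close>.
  This maximization is not a convex problem, but it has no duality gap: the bound holds exactly
  if some multiplier \<open>\<lambda>\<close> together with bounds \<open>t\<^sub>i\<close> for the terms \<open>b\<^sub>i\<^sup>2 / (\<lambda> \<pi>\<^sub>i - r \<alpha>\<^sub>i)\<close> certifies it
  (\<open>ellipsoid_dual\<close>, resting on \<open>trust_region_dual\<close>).  The certificate inequalities are
  products of nonnegative quantities bounding squares, which is what the cone \<open>\<Q>\<close> and the
  constraint on \<open>M\<^sup>1\<^sup>/\<^sup>2 c\<close> say (\<open>qcone_iff\<close>, \<open>rotated_cone_iff\<close>).  The inclusions of \<open>\<T>\<close> in polyhedra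
  are the support function of an ellipsoid (\<open>ellipsoid_in_halfspaces_iff\<close>).

  For the conic representation, every constraint is affine in the coordinates or a norm bounded by
  an affine function, and such constraints are closed under conjunction.  A quadratic
  function that is convex on a set \<open>D\<close> need not be convex off the affine hull of \<open>D\<close>, but on \<open>D\<close> it
  agrees with a sum of squares of affine functions plus an affine function
  (\<open>convex_quadratic_sum_squares\<close>).  Feasible points of the reformulated problem have all states
  and inputs in the constraint sets (\<open>conic_constraints_state_input\<close>), so the cost is of this form on
  the feasible set.  From it both the convexity of the cost and a second-order cone
  constraint for its epigraph can be read off (\<open>sum_squares_coord_convex_quadratic\<close>,
  \<open>sum_squares_socp_representable\<close>).
\<close>

section \<open>Maximizing a quadratic form over an ellipsoid\<close>

text \<open>Strong duality for the trust region problem in diagonal form.  Bounding \<open>2 b\<^sub>i v\<^sub>i\<close> by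
  \<open>(\<lambda> - a\<^sub>i) v\<^sub>i\<^sup>2 + b\<^sub>i\<^sup>2 / (\<lambda> - a\<^sub>i)\<close> gives on the unit sphere the dual bound
  \<open>\<lambda> + \<Sum>\<^sub>i b\<^sub>i\<^sup>2 / (\<lambda> - a\<^sub>i)\<close>, with equality for \<open>v\<^sub>i = b\<^sub>i / (\<lambda> - a\<^sub>i)\<close>.
  If the secular equation \<open>\<Sum>\<^sub>i (b\<^sub>i / (\<lambda> - a\<^sub>i))\<^sup>2 = 1\<close> has a solution \<open>\<lambda>\<close> above \<open>m = max a\<^sub>i\<close>, this
  \<open>v\<close> lies on the sphere and attains the dual bound.  Otherwise \<open>b\<close> vanishes where \<open>a\<close> is maximal,
  and \<open>\<lambda> = m\<close> works: the missing length of \<open>v\<close> is supplied in a maximal coordinate, where it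
  contributes with the weight \<open>m\<close>.\<close>

lemma trust_region_dual:
  fixes a b :: "real^'n"
  assumes bound: "\<And>v :: real^'n. (\<Sum>i\<in>UNIV. (v $ i)\<^sup>2) = 1 \<Longrightarrow>
    (\<Sum>i\<in>UNIV. a $ i * (v $ i)\<^sup>2 + 2 * b $ i * v $ i) \<le> \<gamma>"
  shows "\<exists>lam t :: real^'n. (\<forall>i. 0 \<le> t $ i \<and> a $ i \<le> lam \<and> (b $ i)\<^sup>2 \<le> t $ i * (lam - a $ i)) \<and>
    lam + (\<Sum>i\<in>UNIV. t $ i) \<le> \<gamma>"
proof -
  define m where "m = Max (range (($) a))"
  have am: "a $ i \<le> m" for i
    unfolding m_def by (intro Max_ge) auto
  obtain i0 where i0: "a $ i0 = m"
  proof -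
    have "m \<in> range (($) a)"
      unfolding m_def by (intro Max_in) auto
    then show ?thesis using that by auto
  qed
  \<comment> \<open>the left-hand side of the secular equation\<close>
  define F where "F lam = (\<Sum>i\<in>UNIV. (b $ i / (lam - a $ i))\<^sup>2)" for lam
  show ?thesis
  proof (cases "\<exists>lam>m. 1 \<le> F lam")
    case True
    then obtain lam0 where lam0: "m < lam0" "1 \<le> F lam0" by blast
    define \<beta> where "\<beta> = norm b"
    have b2: "(\<Sum>i\<in>UNIV. (b $ i)\<^sup>2) = \<beta>\<^sup>2"
      unfolding \<beta>_def power2_norm_eq_inner inner_vec_def by (simp add: power2_eq_square)
    have Fle: "F lam \<le> (\<beta> / (lam - m))\<^sup>2" if "m < lam" for lam
    proof -
      have "F lam \<le> (\<Sum>i\<in>UNIV. (b $ i)\<^sup>2 / (lam - m)\<^sup>2)"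
        unfolding F_def power_divide
        using am that
        by (intro sum_mono divide_left_mono power_mono mult_pos_pos zero_less_power)
          (auto simp: algebra_simps less_le_trans intro: le_less_trans)
      then show ?thesis
        by (simp add: sum_divide_distrib[symmetric] b2 power_divide)
    qed
    have "\<beta> \<ge> lam0 - m"
    proof -
      have "1 \<le> (\<beta> / (lam0 - m))\<^sup>2" using Fle[of lam0] lam0 by linarith
      then have "1 \<le> \<beta> / (lam0 - m)"
        using power2_le_imp_le[of 1 "\<beta> / (lam0 - m)"] lam0 by (simp add: \<beta>_def)
      then show ?thesis using lam0 by (simp add: field_simps)
    qed
    then have le: "lam0 \<le> m + \<beta>" and "m < m + \<beta>" using lam0 by auto
    have "F (m + \<beta>) \<le> 1" using Fle[of "m + \<beta>"] \<open>m < m + \<beta>\<close> by simp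
    moreover have "continuous_on {lam0..m + \<beta>} F"
    proof -
      have "lam - a $ i \<noteq> 0" if "lam \<in> {lam0..m + \<beta>}" for lam i
        using that am[of i] lam0(1) by auto
      then show ?thesis unfolding F_def by (intro continuous_intros) auto
    qed
    ultimately obtain lam where lam: "lam0 \<le> lam" "lam \<le> m + \<beta>" "F lam = 1"
      using IVT2'[of F "m + \<beta>" 1 lam0] lam0 le by auto
    have pos: "0 < lam - a $ i" for i
      using am[of i] lam lam0 by linarith
    define v :: "real^'n" where "v = (\<chi> i. b $ i / (lam - a $ i))"
    define t :: "real^'n" where "t = (\<chi> i. (b $ i)\<^sup>2 / (lam - a $ i))"
    have v1: "(\<Sum>i\<in>UNIV. (v $ i)\<^sup>2) = 1"
      using lam(3) by (simp add: v_def F_def)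
    have "a $ i * (v $ i)\<^sup>2 + 2 * b $ i * v $ i = lam * (v $ i)\<^sup>2 + t $ i" for i
    proof -
      have b: "b $ i = (lam - a $ i) * v $ i" using pos[of i] by (simp add: v_def)
      have "t $ i = (lam - a $ i) * (v $ i)\<^sup>2"
        using pos[of i] by (simp add: t_def v_def power2_eq_square)
      then show ?thesis by (simp add: b algebra_simps power2_eq_square)
    qed
    then have "lam + (\<Sum>i\<in>UNIV. t $ i) \<le> \<gamma>"
      using bound[OF v1] v1 by (simp add: sum.distrib sum_distrib_left[symmetric])
    moreover have "0 \<le> t $ i \<and> a $ i \<le> lam \<and> (b $ i)\<^sup>2 \<le> t $ i * (lam - a $ i)" for i
      using pos[of i] by (simp add: t_def)
    ultimately show ?thesis by blast
  next
    case False
    then have F1: "F lam < 1" if "m < lam" for lam using that by force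
    have b0: "b $ i = 0" if "a $ i = m" for i
    proof (rule ccontr)
      assume "b $ i \<noteq> 0"
      then have "1 = (b $ i / ((m + \<bar>b $ i\<bar>) - a $ i))\<^sup>2"
        using that by (simp add: power_divide)
      also have "\<dots> \<le> F (m + \<bar>b $ i\<bar>)"
        unfolding F_def by (intro member_le_sum) auto
      finally show False using F1[of "m + \<bar>b $ i\<bar>"] \<open>b $ i \<noteq> 0\<close> by simp
    qed
    \<comment> \<open>since \<open>x / 0 = 0\<close>, the vector \<open>u\<close> vanishes where \<open>a\<close> is maximal\<close>
    define u where "u i = b $ i / (m - a $ i)" for i
    have bu: "b $ i = (m - a $ i) * u i" for i
      using b0[of i] by (auto simp: u_def)
    define s where "s = (\<Sum>i\<in>UNIV. (u i)\<^sup>2)"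
    have "(F \<longlongrightarrow> s) (at_right m)"
      unfolding F_def s_def
    proof (intro tendsto_sum)
      fix i
      show "((\<lambda>lam. (b $ i / (lam - a $ i))\<^sup>2) \<longlongrightarrow> (u i)\<^sup>2) (at_right m)"
      proof (cases "a $ i = m")
        case True
        then show ?thesis using b0[of i] by (simp add: u_def)
      next
        case False
        then show ?thesis unfolding u_def by (intro tendsto_intros) auto
      qed
    qed
    moreover have "eventually (\<lambda>lam. F lam \<le> 1) (at_right m)"
      unfolding eventually_at_right_field using F1 by (intro exI[of _ "m + 1"]) (auto intro: less_imp_le)
    ultimately have s1: "s \<le> 1"
      by (intro tendsto_upperbound) auto
    define v :: "real^'n" where "v = (\<chi> i. if i = i0 then sqrt (1 - s) else u i)"
    define t :: "real^'n" where "t = (\<chi> i. (m - a $ i) * (u i)\<^sup>2)"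
    have u0: "u i0 = 0" by (simp add: u_def i0)
    have v2: "(v $ i)\<^sup>2 = (u i)\<^sup>2 + (if i = i0 then 1 - s else 0)" for i
      using s1 u0 by (simp add: v_def)
    have v1: "(\<Sum>i\<in>UNIV. (v $ i)\<^sup>2) = 1"
      unfolding v2 by (simp add: sum.distrib s_def)
    have bv: "b $ i * v $ i = b $ i * u i" for i
      using b0[of i0] i0 by (simp add: v_def)
    have "a $ i * (v $ i)\<^sup>2 + 2 * b $ i * v $ i = m * (v $ i)\<^sup>2 + t $ i" for i
    proof -
      have "b $ i * v $ i = (m - a $ i) * (u i)\<^sup>2"
        unfolding bv by (subst bu) (simp add: power2_eq_square)
      moreover have "a $ i * (v $ i)\<^sup>2 = m * (v $ i)\<^sup>2 - (m - a $ i) * (u i)\<^sup>2"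
        using i0 u0 by (cases "i = i0") (simp_all add: v2 algebra_simps)
      ultimately show ?thesis by (simp add: t_def mult.assoc)
    qed
    then have "m + (\<Sum>i\<in>UNIV. t $ i) \<le> \<gamma>"
      using bound[OF v1] v1 by (simp add: sum.distrib sum_distrib_left[symmetric])
    moreover have "0 \<le> t $ i \<and> a $ i \<le> m \<and> (b $ i)\<^sup>2 \<le> t $ i * (m - a $ i)" for i
      using am[of i] by (simp add: t_def) (simp add: bu power2_eq_square mult_ac)
    ultimately show ?thesis by blast
  qed
qed

text \<open>The change of variables \<open>v\<^sub>i \<mapsto> \<surd>\<pi>\<^sub>i v\<^sub>i\<close> turns the ellipsoid into the unit ball, and multiplying
  through by \<open>\<pi>\<^sub>i\<close> turns the certificate on the unit sphere into one that is free of quotients.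
  Passing from the sphere to the solid ellipsoid costs nothing, because
  \<open>\<lambda> \<pi>\<^sub>i \<ge> a\<^sub>i \<ge> 0\<close> makes \<open>\<lambda>\<close> nonnegative.\<close>

lemma ellipsoid_dual:
  fixes a b \<pi> :: "real^'n"
  assumes \<pi>: "\<And>i. 0 < \<pi> $ i" and a: "\<And>i. 0 \<le> a $ i"
  shows "(\<forall>v :: real^'n. (\<Sum>i\<in>UNIV. \<pi> $ i * (v $ i)\<^sup>2) \<le> 1 \<longrightarrow>
      (\<Sum>i\<in>UNIV. a $ i * (v $ i)\<^sup>2 + 2 * b $ i * v $ i) \<le> \<gamma>) \<longleftrightarrow>
    (\<exists>lam t :: real^'n. (\<forall>i. 0 \<le> t $ i \<and> 0 \<le> lam * \<pi> $ i - a $ i \<and>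
      (b $ i)\<^sup>2 \<le> t $ i * (lam * \<pi> $ i - a $ i)) \<and> lam + (\<Sum>i\<in>UNIV. t $ i) \<le> \<gamma>)"
    (is "?L \<longleftrightarrow> ?R")
proof
  assume L: ?L
  define a' b' :: "real^'n" where "a' = (\<chi> i. a $ i / \<pi> $ i)" and "b' = (\<chi> i. b $ i / sqrt (\<pi> $ i))"
  have "(\<Sum>i\<in>UNIV. a' $ i * (v $ i)\<^sup>2 + 2 * b' $ i * v $ i) \<le> \<gamma>"
    if v: "(\<Sum>i\<in>UNIV. (v $ i)\<^sup>2) = 1" for v :: "real^'n"
  proof -
    define v' :: "real^'n" where "v' = (\<chi> i. v $ i / sqrt (\<pi> $ i))"
    have sq: "(v' $ i)\<^sup>2 = (v $ i)\<^sup>2 / \<pi> $ i" for i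
      using \<pi>[of i] by (simp add: v'_def power_divide)
    have "(\<Sum>i\<in>UNIV. \<pi> $ i * (v' $ i)\<^sup>2) \<le> 1"
      using v \<pi> by (simp add: sq less_imp_neq[symmetric])
    then show ?thesis
      using L[rule_format, of v'] by (simp only: sq) (simp add: a'_def b'_def v'_def)
  qed
  from trust_region_dual[OF this] obtain lam and t :: "real^'n"
    where *: "\<And>i. 0 \<le> t $ i \<and> a' $ i \<le> lam \<and> (b' $ i)\<^sup>2 \<le> t $ i * (lam - a' $ i)"
      and sum: "lam + (\<Sum>i\<in>UNIV. t $ i) \<le> \<gamma>" by metis
  have "0 \<le> t $ i \<and> 0 \<le> lam * \<pi> $ i - a $ i \<and> (b $ i)\<^sup>2 \<le> t $ i * (lam * \<pi> $ i - a $ i)" for i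
  proof -
    have "(b $ i)\<^sup>2 / \<pi> $ i \<le> t $ i * (lam - a $ i / \<pi> $ i)" "a $ i / \<pi> $ i \<le> lam"
      using *[of i] \<pi>[of i] by (simp_all add: a'_def b'_def power_divide)
    then have "(b $ i)\<^sup>2 \<le> t $ i * (lam - a $ i / \<pi> $ i) * \<pi> $ i" "a $ i \<le> lam * \<pi> $ i"
      using \<pi>[of i] by (simp_all add: pos_divide_le_eq)
    moreover have "t $ i * (lam - a $ i / \<pi> $ i) * \<pi> $ i = t $ i * (lam * \<pi> $ i - a $ i)"
      using \<pi>[of i] by (simp add: field_simps)
    ultimately show ?thesis using *[of i] by simp
  qed
  with sum show ?R by blast
next
  assume ?R
  then obtain lam and t :: "real^'n"
    where t: "\<And>i. 0 \<le> t $ i" and p: "\<And>i. 0 \<le> lam * \<pi> $ i - a $ i"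
      and b: "\<And>i. (b $ i)\<^sup>2 \<le> t $ i * (lam * \<pi> $ i - a $ i)"
      and sum: "lam + (\<Sum>i\<in>UNIV. t $ i) \<le> \<gamma>" by metis
  have lam: "0 \<le> lam"
  proof -
    have "0 \<le> lam * \<pi> $ undefined" using p[of undefined] a[of undefined] by linarith
    then show ?thesis using \<pi>[of undefined] by (simp add: zero_le_mult_iff)
  qed
  show ?L
  proof (intro allI impI)
    fix v :: "real^'n"
    assume v: "(\<Sum>i\<in>UNIV. \<pi> $ i * (v $ i)\<^sup>2) \<le> 1"
    have pointwise: "a $ i * (v $ i)\<^sup>2 + 2 * b $ i * v $ i \<le> lam * (\<pi> $ i * (v $ i)\<^sup>2) + t $ i" for i
    proof -
      let ?k = "lam * \<pi> $ i - a $ i"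
      have "(2 * (b $ i * v $ i))\<^sup>2 = 4 * ((b $ i)\<^sup>2 * (v $ i)\<^sup>2)"
        by (simp add: power_mult_distrib)
      also have "\<dots> \<le> 4 * ((t $ i * ?k) * (v $ i)\<^sup>2)"
        by (intro mult_left_mono mult_right_mono b) auto
      also have "\<dots> \<le> (?k * (v $ i)\<^sup>2 + t $ i)\<^sup>2"
        using zero_le_power2[of "?k * (v $ i)\<^sup>2 - t $ i"] by (simp add: power2_eq_square algebra_simps)
      finally have "2 * (b $ i * v $ i) \<le> ?k * (v $ i)\<^sup>2 + t $ i"
        by (rule power2_le_imp_le) (intro add_nonneg_nonneg mult_nonneg_nonneg p t zero_le_power2)
      then show ?thesis by (simp add: algebra_simps)
    qed
    have "(\<Sum>i\<in>UNIV. a $ i * (v $ i)\<^sup>2 + 2 * b $ i * v $ i)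
        \<le> (\<Sum>i\<in>UNIV. lam * (\<pi> $ i * (v $ i)\<^sup>2) + t $ i)"
      by (rule sum_mono) (rule pointwise)
    also have "\<dots> = lam * (\<Sum>i\<in>UNIV. \<pi> $ i * (v $ i)\<^sup>2) + (\<Sum>i\<in>UNIV. t $ i)"
      by (simp add: sum.distrib sum_distrib_left)
    also have "\<dots> \<le> \<gamma>"
      using mult_left_mono[OF v lam] sum by simp
    finally show "(\<Sum>i\<in>UNIV. a $ i * (v $ i)\<^sup>2 + 2 * b $ i * v $ i) \<le> \<gamma>" .
  qed
qed

section \<open>Invariance of the terminal set\<close>

lemma inner_matrix_transpose:
  fixes S :: "real^'n^'m"
  shows "(S *v x) \<bullet> y = x \<bullet> (transpose S *v y)"
  by (metis dot_lmul_matrix vector_transpose_matrix)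

lemma inner_diag_matrix: "v \<bullet> (diag_matrix d *v v) = (\<Sum>i\<in>UNIV. d $ i * (v $ i)\<^sup>2)"
proof -
  have "diag_matrix d *v v = (\<chi> i. d $ i * v $ i)"
    by (simp add: vec_eq_iff diag_matrix_def matrix_vector_mult_def if_distrib[of "\<lambda>x. x * _"] cong: if_cong)
  then show ?thesis
    by (simp add: inner_vec_def power2_eq_square mult_ac)
qed

lemma matrix_inv_inverse:
  fixes R :: "real^'n^'n"
  assumes "invertible R"
  shows "R ** matrix_inv R = mat 1" "matrix_inv R ** R = mat 1"
  using someI_ex[OF assms[unfolded invertible_def]] by (simp_all add: matrix_inv_def)

text \<open>With \<open>d = (A\<^sub>c\<^sub>l - I) c\<close>, the point \<open>y = c + r S v\<close> is mapped to \<open>c + d + r A\<^sub>c\<^sub>l S v\<close>, whose squared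
  \<open>P\<close>-distance from \<open>c\<close> is \<open>q + r (2 b \<bullet> v + \<Sum>\<^sub>i r \<alpha>\<^sub>i v\<^sub>i\<^sup>2)\<close>.  Dividing the bound \<open>r\<^sup>2\<close> by \<open>r\<close> before
  dualizing keeps the certificate linear in \<open>r\<close>; the multiplier is \<open>1/r\<close> times the one of the
  undivided inequality.\<close>

lemma invariant_terminal_set_iff:
  fixes P Acl S :: "real^'n^'n" and c :: "real^'n"
  assumes P: "pos_def P" and S: "invertible S" and r: "r > 0"
    and S_P: "transpose S ** P ** S = diag_matrix \<pi>"
    and S_A: "transpose S ** transpose Acl ** P ** Acl ** S = diag_matrix \<alpha>"
  defines "b \<equiv> transpose S ** transpose Acl ** P ** (Acl - mat 1) *v c"
    and "q \<equiv> ((Acl - mat 1) *v c) \<bullet> (P *v ((Acl - mat 1) *v c))"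
  shows "(\<forall>y\<in>terminal_set P c r. Acl *v y \<in> terminal_set P c r) \<longleftrightarrow>
    (\<exists>lam t :: real^'n. (\<forall>i. 0 \<le> t $ i \<and> 0 \<le> lam * \<pi> $ i - r * \<alpha> $ i \<and>
      (b $ i)\<^sup>2 \<le> t $ i * (lam * \<pi> $ i - r * \<alpha> $ i)) \<and> q \<le> r * (r - lam - (\<Sum>i\<in>UNIV. t $ i)))"
proof -
  have sym: "transpose P = P" using P by (simp add: pos_def_def)
  have form_P: "(S *v v) \<bullet> (P *v (S *v v)) = (\<Sum>i\<in>UNIV. \<pi> $ i * (v $ i)\<^sup>2)" for v
    unfolding inner_diag_matrix[symmetric] S_P[symmetric]
    by (simp add: inner_matrix_transpose matrix_vector_mul_assoc matrix_mul_assoc)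
  have form_A: "(Acl *v (S *v v)) \<bullet> (P *v (Acl *v (S *v v))) = (\<Sum>i\<in>UNIV. \<alpha> $ i * (v $ i)\<^sup>2)" for v
    unfolding inner_diag_matrix[symmetric] S_A[symmetric]
    by (simp add: inner_matrix_transpose matrix_transpose_mul matrix_vector_mul_assoc matrix_mul_assoc)
  have S_inj: "S *v v \<noteq> 0" if "v \<noteq> 0" for v
  proof
    assume "S *v v = 0"
    then have "(matrix_inv S ** S) *v v = 0" by (simp add: matrix_vector_mul_assoc[symmetric])
    then show False using that S by (simp add: matrix_inv_inverse)
  qed
  have axis_sum: "(\<Sum>j\<in>UNIV. d $ j * (axis i 1 $ j)\<^sup>2) = d $ i" for d :: "real^'n" and i
    by (simp add: axis_def if_distrib[of "\<lambda>x. _ * x"] if_distrib[of "\<lambda>x. x\<^sup>2"] cong: if_cong)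
  have \<pi>: "0 < \<pi> $ i" for i
  proof -
    have "S *v axis i 1 \<noteq> 0" using S_inj by (simp add: axis_eq_0_iff)
    then have "0 < (S *v axis i 1) \<bullet> (P *v (S *v axis i 1))" using P unfolding pos_def_def by blast
    then show ?thesis unfolding form_P axis_sum .
  qed
  have \<alpha>: "0 \<le> \<alpha> $ i" for i
    using P form_A[of "axis i 1"]
    by (cases "Acl *v (S *v axis i 1) = 0") (auto simp: pos_def_def axis_sum less_imp_le)
  have shift: "c + r *\<^sub>R (S *v v) \<in> terminal_set P c r \<longleftrightarrow> (\<Sum>i\<in>UNIV. \<pi> $ i * (v $ i)\<^sup>2) \<le> 1" for v
    using r form_P[of v] by (simp add: terminal_set_def matrix_vector_mult_scaleR power2_eq_square)
  have image: "Acl *v (c + r *\<^sub>R (S *v v)) \<in> terminal_set P c r \<longleftrightarrow>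
      (\<Sum>i\<in>UNIV. (r *\<^sub>R \<alpha>) $ i * (v $ i)\<^sup>2 + 2 * b $ i * v $ i) \<le> r - q / r" for v
  proof -
    let ?d = "(Acl - mat 1) *v c" and ?w = "Acl *v (S *v v)"
    have split: "Acl *v (c + r *\<^sub>R (S *v v)) - c = ?d + r *\<^sub>R ?w"
      by (simp add: matrix_vector_mult_add_rdistrib matrix_vector_right_distrib
          matrix_vector_mult_diff_rdistrib matrix_vector_mult_scaleR)
    have swap: "?d \<bullet> (P *v ?w) = ?w \<bullet> (P *v ?d)"
      by (metis inner_commute inner_matrix_transpose sym)
    have "?w \<bullet> (P *v ?d) = v \<bullet> b"
      unfolding b_def by (simp add: inner_matrix_transpose matrix_transpose_mul matrix_vector_mul_assoc matrix_mul_assoc)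
    then have quad: "(?d + r *\<^sub>R ?w) \<bullet> (P *v (?d + r *\<^sub>R ?w)) = q + r * (2 * (v \<bullet> b) + r * (?w \<bullet> (P *v ?w)))"
      using swap
      by (simp add: q_def matrix_vector_right_distrib matrix_vector_mult_scaleR inner_left_distrib
          inner_right_distrib algebra_simps)
    define X where "X = (\<Sum>i\<in>UNIV. (r *\<^sub>R \<alpha>) $ i * (v $ i)\<^sup>2 + 2 * b $ i * v $ i)"
    have "X = 2 * (v \<bullet> b) + r * (?w \<bullet> (P *v ?w))"
      unfolding form_A X_def by (simp add: inner_vec_def sum.distrib sum_distrib_left mult_ac)
    with quad have "(?d + r *\<^sub>R ?w) \<bullet> (P *v (?d + r *\<^sub>R ?w)) = q + r * X" by simp
    then show ?thesis
      unfolding terminal_set_def mem_Collect_eq split X_def[symmetric]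
      using r by (simp add: field_simps power2_eq_square)
  qed
  have "(\<forall>y\<in>terminal_set P c r. Acl *v y \<in> terminal_set P c r) \<longleftrightarrow>
    (\<forall>v. (\<Sum>i\<in>UNIV. \<pi> $ i * (v $ i)\<^sup>2) \<le> 1 \<longrightarrow>
      (\<Sum>i\<in>UNIV. (r *\<^sub>R \<alpha>) $ i * (v $ i)\<^sup>2 + 2 * b $ i * v $ i) \<le> r - q / r)" (is "?inv \<longleftrightarrow> ?bd")
  proof -
    have "?inv \<longleftrightarrow> (\<forall>v. c + r *\<^sub>R (S *v v) \<in> terminal_set P c r \<longrightarrow>
        Acl *v (c + r *\<^sub>R (S *v v)) \<in> terminal_set P c r)"
    proof (intro iffI ballI allI impI)
      fix y
      assume *: "\<forall>v. c + r *\<^sub>R (S *v v) \<in> terminal_set P c r \<longrightarrow>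
          Acl *v (c + r *\<^sub>R (S *v v)) \<in> terminal_set P c r"
        and y: "y \<in> terminal_set P c r"
      have "c + r *\<^sub>R (S *v (matrix_inv S *v ((1 / r) *\<^sub>R (y - c)))) = y"
        using r S by (simp add: matrix_vector_mul_assoc matrix_inv_inverse)
      then show "Acl *v y \<in> terminal_set P c r"
        using *[rule_format, of "matrix_inv S *v ((1 / r) *\<^sub>R (y - c))"] y by simp
    qed simp
    then show ?thesis unfolding shift image .
  qed
  also have "\<dots> \<longleftrightarrow> (\<exists>lam t :: real^'n. (\<forall>i. 0 \<le> t $ i \<and> 0 \<le> lam * \<pi> $ i - (r *\<^sub>R \<alpha>) $ i \<and>
      (b $ i)\<^sup>2 \<le> t $ i * (lam * \<pi> $ i - (r *\<^sub>R \<alpha>) $ i)) \<and> lam + (\<Sum>i\<in>UNIV. t $ i) \<le> r - q / r)"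
    using \<pi> \<alpha> r by (intro ellipsoid_dual) simp_all
  also have "\<dots> \<longleftrightarrow> (\<exists>lam t :: real^'n. (\<forall>i. 0 \<le> t $ i \<and> 0 \<le> lam * \<pi> $ i - r * \<alpha> $ i \<and>
      (b $ i)\<^sup>2 \<le> t $ i * (lam * \<pi> $ i - r * \<alpha> $ i)) \<and> q \<le> r * (r - lam - (\<Sum>i\<in>UNIV. t $ i)))"
    using r by (intro ex_cong1) (simp add: field_simps)
  finally show ?thesis .
qed

section \<open>The terminal set in polyhedra and the conic reformulation\<close>

lemma sqrt_le_iff_square: "0 \<le> a \<Longrightarrow> sqrt a \<le> s \<longleftrightarrow> 0 \<le> s \<and> a \<le> s\<^sup>2" for a s :: real
  using real_le_lsqrt[of s a] sqrt_le_D[of a s] order_trans[of 0 "sqrt a" s] by auto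

lemma norm_le_iff_sum_squares: "norm (x, y::real) \<le> s \<longleftrightarrow> 0 \<le> s \<and> (norm x)\<^sup>2 + y\<^sup>2 \<le> s\<^sup>2"
  by (simp add: norm_Pair sqrt_le_iff_square)

lemma qcone_iff: "(x, y, z) \<in> qcone \<longleftrightarrow> 0 \<le> y \<and> 0 \<le> z \<and> x\<^sup>2 \<le> y * z"
proof -
  have "(x, y, z) \<in> qcone \<longleftrightarrow> 0 \<le> y + z \<and> x\<^sup>2 \<le> y * z"
    unfolding qcone_def by (simp add: norm_le_iff_sum_squares power2_eq_square algebra_simps)
  also have "\<dots> \<longleftrightarrow> 0 \<le> y \<and> 0 \<le> z \<and> x\<^sup>2 \<le> y * z"
  proof -
    have "0 \<le> y \<and> 0 \<le> z" if "0 \<le> y + z" "x\<^sup>2 \<le> y * z"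
    proof -
      have "0 \<le> y * z" using that(2) zero_le_power2[of x] by linarith
      then show ?thesis using that(1) by (auto simp: zero_le_mult_iff)
    qed
    then show ?thesis by auto
  qed
  finally show ?thesis .
qed

text \<open>The hyperbolic constraint \<open>\<parallel>x\<parallel>\<^sup>2 \<le> r (r - s)\<close> as a norm bound, by
  \<open>4 r (r - s) = (2 r - s)\<^sup>2 - s\<^sup>2\<close>.\<close>

lemma rotated_cone_iff:
  assumes "r > 0"
  shows "norm (2 *\<^sub>R x, s) \<le> 2 * r - s \<longleftrightarrow> (norm x)\<^sup>2 \<le> r * (r - s)"
proof -
  have "norm (2 *\<^sub>R x, s) \<le> 2 * r - s \<longleftrightarrow> 0 \<le> 2 * r - s \<and> (norm x)\<^sup>2 \<le> r * (r - s)"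
  proof -
    have "(norm (2 *\<^sub>R x))\<^sup>2 + s\<^sup>2 \<le> (2 * r - s)\<^sup>2 \<longleftrightarrow> 4 * (norm x)\<^sup>2 \<le> 4 * (r * (r - s))"
      by (simp add: power2_eq_square algebra_simps)
    then show ?thesis unfolding norm_le_iff_sum_squares by simp
  qed
  moreover have "0 \<le> 2 * r - s" if "(norm x)\<^sup>2 \<le> r * (r - s)"
  proof -
    have "0 \<le> r * (r - s)" using that zero_le_power2[of "norm x"] by linarith
    then show ?thesis using assms by (simp add: zero_le_mult_iff)
  qed
  ultimately show ?thesis by blast
qed

lemma psd_sqrt_form:
  assumes "is_psd_sqrt R Q"
  shows "x \<bullet> (Q *v x) = (norm (R *v x))\<^sup>2"
proof -
  have "R ** R = Q" "transpose R = R" using assms by (auto simp: is_psd_sqrt_def pos_semidef_def)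
  then show ?thesis
    by (metis power2_norm_eq_inner inner_matrix_transpose matrix_vector_mul_assoc)
qed

lemma psd_sqrt_invertible:
  assumes "is_psd_sqrt R P" "pos_def P"
  shows "invertible R"
proof -
  have "x = 0" if "R *v x = 0" for x
    using psd_sqrt_form[OF assms(1), of x] assms(2) that by (auto simp: pos_def_def)
  then show ?thesis
    by (simp add: invertible_left_inverse matrix_left_invertible_ker)
qed

lemma terminal_set_eq:
  assumes "is_psd_sqrt R P" "0 \<le> r"
  shows "terminal_set P c r = {y. norm (R *v (y - c)) \<le> r}"
  using assms by (auto simp: terminal_set_def psd_sqrt_form intro: power2_le_imp_le power_mono)

text \<open>The points of the ellipsoid are \<open>c + R\<^sup>-\<^sup>1 w\<close> with \<open>\<parallel>w\<parallel> \<le> r\<close>, and \<open>a \<bullet> R\<^sup>-\<^sup>1 w\<close> is largest for \<open>w\<close> in the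
  direction of \<open>R\<^sup>-\<^sup>T a\<close>.\<close>

lemma ellipsoid_in_halfspace_iff:
  fixes R :: "real^'n^'n"
  assumes R: "invertible R" and r: "0 \<le> r"
  shows "(\<forall>y. norm (R *v (y - c)) \<le> r \<longrightarrow> a \<bullet> y \<le> \<beta>) \<longleftrightarrow>
    a \<bullet> c + norm (transpose (matrix_inv R) *v a) * r \<le> \<beta>"
proof -
  define g where "g = transpose (matrix_inv R) *v a"
  have ga: "a \<bullet> (matrix_inv R *v w) = g \<bullet> w" for w
    by (metis g_def inner_commute inner_matrix_transpose)
  show ?thesis
  proof
    assume L: "\<forall>y. norm (R *v (y - c)) \<le> r \<longrightarrow> a \<bullet> y \<le> \<beta>"
    define w where "w = (r / norm g) *\<^sub>R g"
    have "R *v ((c + matrix_inv R *v w) - c) = w"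
      using R by (simp add: matrix_vector_mul_assoc matrix_inv_inverse)
    moreover have "norm w \<le> r" using r by (simp add: w_def)
    ultimately have "a \<bullet> (c + matrix_inv R *v w) \<le> \<beta>" using L by simp
    moreover have "g \<bullet> w = norm g * r"
      by (cases "g = 0") (simp_all add: w_def power2_norm_eq_inner[symmetric] power2_eq_square)
    ultimately show "a \<bullet> c + norm (transpose (matrix_inv R) *v a) * r \<le> \<beta>"
      by (simp add: inner_right_distrib ga g_def)
  next
    assume *: "a \<bullet> c + norm (transpose (matrix_inv R) *v a) * r \<le> \<beta>"
    show "\<forall>y. norm (R *v (y - c)) \<le> r \<longrightarrow> a \<bullet> y \<le> \<beta>"
    proof (intro allI impI)
      fix y assume y: "norm (R *v (y - c)) \<le> r"
      have "a \<bullet> (y - c) = g \<bullet> (R *v (y - c))"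
        using R by (simp add: ga[symmetric] matrix_vector_mul_assoc matrix_inv_inverse)
      also have "\<dots> \<le> norm g * r"
        using y by (intro order_trans[OF norm_cauchy_schwarz] mult_left_mono) auto
      finally show "a \<bullet> y \<le> \<beta>" using * by (simp add: g_def inner_diff_right)
    qed
  qed
qed

lemma matrix_vector_le_iff:
  fixes F :: "real^'n^'m"
  shows "F *v y \<le> h \<longleftrightarrow> (\<forall>j. row j F \<bullet> y \<le> h $ j)"
  by (simp add: less_eq_vec_def matrix_vector_mul_component row_def)

lemma row_matrix_mult:
  fixes F :: "real^'n^'m"
  shows "row j (F ** R) = transpose R *v row j F"
  by (auto simp: vec_eq_iff row_def matrix_matrix_mult_def matrix_vector_mult_def transpose_def
      intro!: sum.cong mult.commute)

lemma ellipsoid_in_halfspaces_iff: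
  fixes R :: "real^'n^'n" and F :: "real^'n^'m"
  assumes "invertible R" "0 \<le> r"
  shows "(\<forall>y. norm (R *v (y - c)) \<le> r \<longrightarrow> F *v y \<le> h) \<longleftrightarrow>
    (\<forall>j. row j F \<bullet> c + norm (row j (F ** matrix_inv R)) * r \<le> h $ j)"
  unfolding matrix_vector_le_iff row_matrix_mult ellipsoid_in_halfspace_iff[OF assms, symmetric] by blast

lemma mpc_feasible_iff_conic_feasible:
  fixes A P Ph M Mh S :: "real^'nx^'nx" and B :: "real^'nu^'nx" and K :: "real^'nx^'nu"
  assumes P: "pos_def P" and S: "invertible S"
    and S_P: "transpose S ** P ** S = diag_matrix \<pi>"
    and S_A: "transpose S ** transpose (A + B ** K) ** P ** (A + B ** K) ** S = diag_matrix \<alpha>"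
    and M: "M = transpose (A + B ** K - mat 1) ** P ** (A + B ** K - mat 1)"
    and Ph: "is_psd_sqrt Ph P"
    and Mh: "is_psd_sqrt Mh M"
  shows "mpc_feasible N A B K E f G h P x_init u x c r \<longleftrightarrow>
    (\<exists>lam t. conic_feasible N A B K E f G h P Ph Mh S \<pi> \<alpha> x_init u x c r lam t)"
proof (cases "r > 0")
  case r: True
  let ?Acl = "A + B ** K"
  have T: "terminal_set P c r = {y. norm (Ph *v (y - c)) \<le> r}"
    using terminal_set_eq[OF Ph] r by simp
  have inv: "invertible Ph" using psd_sqrt_invertible[OF Ph P] .
  have q: "((?Acl - mat 1) *v c) \<bullet> (P *v ((?Acl - mat 1) *v c)) = (norm (Mh *v c))\<^sup>2"
    unfolding psd_sqrt_form[OF Mh, symmetric] M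
    by (simp add: inner_matrix_transpose matrix_vector_mul_assoc matrix_mul_assoc)
  note inv_iff = invariant_terminal_set_iff[OF P S r S_P S_A, of c]
  have "(\<forall>y\<in>terminal_set P c r. ?Acl *v y \<in> terminal_set P c r) \<longleftrightarrow>
    (\<exists>lam t. norm (2 *\<^sub>R (Mh *v c), (\<Sum>i\<in>UNIV. t $ i) + lam) \<le> 2 * r - (\<Sum>i\<in>UNIV. t $ i) - lam \<and>
     (\<forall>i. ((transpose S ** transpose ?Acl ** P ** (?Acl - mat 1) *v c) $ i,
           t $ i, lam * \<pi> $ i - r * \<alpha> $ i) \<in> qcone))"
    unfolding inv_iff qcone_iff q diff_diff_add
      rotated_cone_iff[OF r]
    by (simp add: add.commute conj_commute)
  moreover have "(\<forall>y\<in>terminal_set P c r. y \<in> halfspaces E f) \<longleftrightarrow>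
      (\<forall>j. row j E \<bullet> c + norm (row j (E ** matrix_inv Ph)) * r \<le> f $ j)"
    unfolding ellipsoid_in_halfspaces_iff[OF inv less_imp_le[OF r], symmetric] T halfspaces_def by simp
  moreover have "(\<forall>y\<in>terminal_set P c r. K *v y \<in> halfspaces G h) \<longleftrightarrow>
      (\<forall>j. row j (G ** K) \<bullet> c + norm (row j (G ** K ** matrix_inv Ph)) * r \<le> h $ j)"
    unfolding ellipsoid_in_halfspaces_iff[OF inv less_imp_le[OF r], symmetric] T halfspaces_def
    by (simp add: matrix_vector_mul_assoc)
  moreover have "x N \<in> terminal_set P c r \<longleftrightarrow> norm (Ph *v (x N - c)) \<le> r"
    by (simp add: T)
  ultimately show ?thesis
    unfolding mpc_feasible_def conic_feasible_def conic_constraints_def ball_conj_distrib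
    by (auto simp: halfspaces_def r)
qed (simp add: mpc_feasible_def conic_feasible_def)

section \<open>Second-order cone descriptions\<close>

text \<open>Vector-valued affine functions of the coordinates in \<open>V\<close>.  Admitting an arbitrary target
  space lets matrix products, inner products and components all be treated as linear images.\<close>

definition coord_affine :: "'v set \<Rightarrow> (('v \<Rightarrow> real) \<Rightarrow> 'e::real_vector) \<Rightarrow> bool" where
  "coord_affine V g \<longleftrightarrow> (\<exists>a b. \<forall>z. g z = (\<Sum>v\<in>V. z v *\<^sub>R a v) + b)"

lemma coord_affine_real: "coord_affine V g \<longleftrightarrow> (\<exists>a b. \<forall>z. g z = lin_form V a z + b)"
  by (simp add: coord_affine_def lin_form_def mult.commute)

lemma coord_affine_coord: "finite V \<Longrightarrow> v \<in> V \<Longrightarrow> coord_affine V (\<lambda>z. z v)"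
  unfolding coord_affine_real lin_form_def
  by (rule exI[of _ "\<lambda>w. if w = v then 1 else 0"], rule exI[of _ 0])
    (simp add: if_distrib[of "\<lambda>x. x * _"] cong: if_cong)

lemma coord_affine_const: "coord_affine V (\<lambda>z. b)"
  unfolding coord_affine_def by (rule exI[of _ "\<lambda>v. 0"], rule exI[of _ b]) simp

lemma coord_affine_add:
  assumes "coord_affine V g" "coord_affine V k"
  shows "coord_affine V (\<lambda>z. g z + k z)"
proof -
  obtain a b a' b' where "\<And>z. g z = (\<Sum>v\<in>V. z v *\<^sub>R a v) + b" "\<And>z. k z = (\<Sum>v\<in>V. z v *\<^sub>R a' v) + b'"
    using assms unfolding coord_affine_def by metis
  then show ?thesis
    unfolding coord_affine_def
    by (intro exI[of _ "\<lambda>v. a v + a' v"] exI[of _ "b + b'"]) (simp add: scaleR_right_distrib sum.distrib)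
qed

text \<open>For uses of this rule the linear map has to be given, since matching
  \<open>L (g z)\<close> against a term has many solutions; hence the instances below.\<close>

lemma coord_affine_linear:
  assumes "linear L" "coord_affine V g"
  shows "coord_affine V (\<lambda>z. L (g z))"
proof -
  obtain a b where "\<And>z. g z = (\<Sum>v\<in>V. z v *\<^sub>R a v) + b"
    using assms(2) unfolding coord_affine_def by metis
  then show ?thesis
    unfolding coord_affine_def
    by (intro exI[of _ "\<lambda>v. L (a v)"] exI[of _ "L b"])
      (simp add: linear_add[OF assms(1)] linear_sum[OF assms(1)] linear_cmul[OF assms(1)])
qed

lemma coord_affine_sum:
  "(\<And>i. i \<in> I \<Longrightarrow> coord_affine V (g i)) \<Longrightarrow> coord_affine V (\<lambda>z. \<Sum>i\<in>I. g i z)"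
  by (induction I rule: infinite_finite_induct) (auto intro: coord_affine_const coord_affine_add)

lemma coord_affine_scaleR: "coord_affine V g \<Longrightarrow> coord_affine V (\<lambda>z. s *\<^sub>R g z)"
  by (rule coord_affine_linear[where L = "\<lambda>x. s *\<^sub>R x"]) (simp_all add: linear_scale_self)

lemma coord_affine_mult_left: "coord_affine V g \<Longrightarrow> coord_affine V (\<lambda>z. s * g z)" for s :: real
  using coord_affine_scaleR[of V g s] by simp

lemma coord_affine_mult_right: "coord_affine V g \<Longrightarrow> coord_affine V (\<lambda>z. g z * s)" for s :: real
  using coord_affine_mult_left[of V g s] by (simp add: mult.commute)

lemma coord_affine_diff: "coord_affine V g \<Longrightarrow> coord_affine V k \<Longrightarrow> coord_affine V (\<lambda>z. g z - k z)"
  using coord_affine_add[OF _ coord_affine_scaleR[of V k "-1"], of g] by simp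

lemma coord_affine_inner: "coord_affine V g \<Longrightarrow> coord_affine V (\<lambda>z. a \<bullet> g z)"
  by (rule coord_affine_linear[where L = "\<lambda>x. a \<bullet> x"])
    (auto intro: bounded_linear.linear bounded_linear_inner_right)

lemma coord_affine_matrix: "coord_affine V g \<Longrightarrow> coord_affine V (\<lambda>z. A *v g z)"
  for A :: "real^'n^'m"
  by (rule coord_affine_linear[where L = "\<lambda>x. A *v x"]) auto

lemma coord_affine_component: "coord_affine V g \<Longrightarrow> coord_affine V (\<lambda>z. g z $ i)"
  for g :: "_ \<Rightarrow> real^'n"
  by (rule coord_affine_linear[where L = "\<lambda>x. x $ i"])
    (auto intro: bounded_linear.linear bounded_linear_vec_nth)

lemma coord_affine_Pair:
  assumes "coord_affine V g" "coord_affine V k"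
  shows "coord_affine V (\<lambda>z. (g z, k z))"
proof -
  have "linear (\<lambda>x. (x, 0))" "linear (\<lambda>y. (0, y))" by (auto intro: linearI)
  then have "coord_affine V (\<lambda>z. (g z, 0))" "coord_affine V (\<lambda>z. (0, k z))"
    using coord_affine_linear[where L = "\<lambda>x. (x, 0)", of V g]
      coord_affine_linear[where L = "\<lambda>y. (0, y)", of V k] assms by auto
  then show ?thesis
    using coord_affine_add[of V "\<lambda>z. (g z, 0)" "\<lambda>z. (0, k z)"] by simp
qed

lemma coord_affine_vec:
  assumes "\<And>i. coord_affine V (\<lambda>z. g z i)"
  shows "coord_affine V (\<lambda>z. (\<chi> i. g z i) :: real^'n)"
proof -
  have "coord_affine V (\<lambda>z. \<Sum>i\<in>UNIV. g z i *\<^sub>R (axis i 1 :: real^'n))"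
    using assms
    by (intro coord_affine_sum coord_affine_linear[where L = "\<lambda>s. s *\<^sub>R (axis _ 1 :: real^'n)"] linearI)
      (auto simp: scaleR_left_distrib)
  moreover have "(\<Sum>i\<in>UNIV. g z i *\<^sub>R (axis i 1 :: real^'n)) = (\<chi> i. g z i)" for z
    by (simp add: vec_eq_iff axis_def if_distrib[of "\<lambda>x. _ * x"] cong: if_cong)
  ultimately show ?thesis by simp
qed

lemma coord_affine_Inl:
  fixes W :: "'w set"
  assumes V: "finite V" "finite W" and g: "coord_affine V g"
  shows "coord_affine (V <+> W) (\<lambda>y. g (\<lambda>v. y (Inl v)))"
proof -
  obtain a b where "\<And>z. g z = (\<Sum>v\<in>V. z v *\<^sub>R a v) + b"
    using g unfolding coord_affine_def by metis
  then show ?thesis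
    unfolding coord_affine_def using V
    by (intro exI[of _ "case_sum a (\<lambda>_. 0)"] exI[of _ b]) (simp add: sum.Plus)
qed

lemma coord_affine_convex_comb:
  fixes g :: "('v \<Rightarrow> real) \<Rightarrow> real"
  assumes "coord_affine V g"
  shows "g (\<lambda>v. (1 - s) * y v + s * z v) = (1 - s) * g y + s * g z"
proof -
  obtain a b where "\<And>z. g z = lin_form V a z + b"
    using assms unfolding coord_affine_real by metis
  moreover have "lin_form V a (\<lambda>v. (1 - s) * y v + s * z v) = (1 - s) * lin_form V a y + s * lin_form V a z"
    unfolding lin_form_def sum_distrib_left sum.distrib[symmetric]
    by (intro sum.cong) (simp_all add: algebra_simps)
  ultimately show ?thesis by (simp add: algebra_simps)
qed

lemmas coord_affine_intros =
  coord_affine_const coord_affine_add coord_affine_diff coord_affine_sum coord_affine_scaleR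
  coord_affine_mult_left coord_affine_mult_right coord_affine_inner coord_affine_matrix
  coord_affine_component coord_affine_Pair

lemma soc_describable_True: "finite V \<Longrightarrow> soc_describable V (\<lambda>z. True)"
  unfolding soc_describable_def socp_feasible_def
  by (auto intro!: exI[of _ "\<lparr>objective = undefined, cones = [], eqs = []\<rparr>"])

lemma soc_describable_conj:
  assumes "soc_describable V F" "soc_describable V H"
  shows "soc_describable V (\<lambda>z. F z \<and> H z)"
proof -
  obtain p q where "\<And>z. F z = socp_feasible V p z" "\<And>z. H z = socp_feasible V q z"
    using assms unfolding soc_describable_def by metis
  then have "F z \<and> H z \<longleftrightarrow> socp_feasible V \<lparr>objective = undefined, cones = cones p @ cones q, eqs = eqs p @ eqs q\<rparr> z" for z
    by (auto simp: socp_feasible_def ball_Un)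
  moreover have "finite V" using assms(1) by (simp add: soc_describable_def)
  ultimately show ?thesis unfolding soc_describable_def by blast
qed

lemma soc_describable_Ball:
  assumes "finite V" "finite I" "\<And>i. i \<in> I \<Longrightarrow> soc_describable V (F i)"
  shows "soc_describable V (\<lambda>z. \<forall>i\<in>I. F i z)"
  using assms(2,3)
  by (induction I rule: finite_induct) (auto intro: soc_describable_True soc_describable_conj assms(1))

lemma soc_describable_list:
  assumes V: "finite V" and gs: "\<And>g. g \<in> set gs \<Longrightarrow> coord_affine V g" and k: "coord_affine V k"
  shows "soc_describable V (\<lambda>z. sqrt (\<Sum>g\<leftarrow>gs. (g z)\<^sup>2) \<le> k z)"
proof -
  obtain c d where k: "\<And>z. k z = lin_form V c z + d"
    using k unfolding coord_affine_real by metis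
  have "\<forall>g\<in>set gs. \<exists>ab. \<forall>z. g z = lin_form V (fst ab) z + snd ab"
    using gs unfolding coord_affine_real by simp
  then obtain ab where ab: "\<And>g z. g \<in> set gs \<Longrightarrow> g z = lin_form V (fst (ab g)) z + snd (ab g)"
    by metis
  define C where "C = \<lparr>soc_rows = map ab gs, soc_c = c, soc_d = d\<rparr>"
  have "soc_sat V C z \<longleftrightarrow> sqrt (\<Sum>g\<leftarrow>gs. (g z)\<^sup>2) \<le> k z" for z
  proof -
    have "(\<Sum>i<length gs. (lin_form V (fst (ab (gs ! i))) z + snd (ab (gs ! i)))\<^sup>2) = (\<Sum>g\<leftarrow>gs. (g z)\<^sup>2)"
      unfolding sum_list_sum_nth by (auto simp: ab[symmetric] atLeast0LessThan intro!: sum.cong)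
    then show ?thesis by (simp add: soc_sat_def L2_set_def C_def k)
  qed
  then show ?thesis
    unfolding soc_describable_def socp_feasible_def
    using V by (intro conjI exI[of _ "\<lparr>objective = undefined, cones = [C], eqs = []\<rparr>"]) auto
qed

lemma soc_describable_norm:
  fixes g :: "('v \<Rightarrow> real) \<Rightarrow> 'e::euclidean_space"
  assumes "finite V" "coord_affine V g" "coord_affine V k"
  shows "soc_describable V (\<lambda>z. norm (g z) \<le> k z)"
proof -
  obtain bs :: "'e list" where bs: "distinct bs" "set bs = Basis"
    using finite_distinct_list[OF finite_Basis] by blast
  have "norm (g z) = sqrt (\<Sum>k\<leftarrow>map (\<lambda>b z. b \<bullet> g z) bs. (k z)\<^sup>2)" for z
    unfolding norm_eq_sqrt_inner
    by (subst euclidean_inner) (simp add: o_def sum_list_distinct_conv_sum_set[OF bs(1)] bs(2) power2_eq_square inner_commute)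
  moreover have "soc_describable V (\<lambda>z. sqrt (\<Sum>k\<leftarrow>map (\<lambda>b z. b \<bullet> g z) bs. (k z)\<^sup>2) \<le> k z)"
    using assms by (intro soc_describable_list) (auto intro: coord_affine_inner)
  ultimately show ?thesis by simp
qed

lemma soc_describable_le:
  fixes g k :: "('v \<Rightarrow> real) \<Rightarrow> real"
  assumes "finite V" "coord_affine V g" "coord_affine V k"
  shows "soc_describable V (\<lambda>z. g z \<le> k z)"
  using soc_describable_norm[OF assms(1) coord_affine_const[of V "0::real"] coord_affine_diff[OF assms(3,2)]]
  by simp

lemma soc_describable_eq:
  fixes g k :: "('v \<Rightarrow> real) \<Rightarrow> 'e::euclidean_space"
  assumes V: "finite V" and gk: "coord_affine V g" "coord_affine V k"
  shows "soc_describable V (\<lambda>z. g z = k z)"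
proof -
  have zero: "soc_describable V (\<lambda>z. s z = 0)" if s: "coord_affine V s" for s :: "_ \<Rightarrow> real"
  proof -
    obtain a b where "\<And>z. s z = lin_form V a z + b"
      using s unfolding coord_affine_real by metis
    then show ?thesis
      unfolding soc_describable_def socp_feasible_def using V
      by (intro conjI exI[of _ "\<lparr>objective = undefined, cones = [], eqs = [(a, - b)]\<rparr>"]) auto
  qed
  have "soc_describable V (\<lambda>z. \<forall>b\<in>Basis. b \<bullet> (g z - k z) = 0)"
    by (intro soc_describable_Ball zero coord_affine_inner coord_affine_diff gk V finite_Basis)
  moreover have "g z = k z \<longleftrightarrow> (\<forall>b\<in>Basis. b \<bullet> (g z - k z) = 0)" for z
    by (auto simp: euclidean_eq_iff[of "g z"] inner_diff_right inner_commute)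
  ultimately show ?thesis by simp
qed

text \<open>Equations are preserved by convex combinations, and the cone constraints by the triangle
  inequality for the Euclidean norm.\<close>

lemma soc_describable_convex:
  assumes "soc_describable V F" "F y" "F z" "s \<in> {0..1}"
  shows "F (\<lambda>v. (1 - s) * y v + s * z v)"
proof -
  obtain p where p: "\<And>z. F z \<longleftrightarrow> socp_feasible V p z"
    using assms(1) unfolding soc_describable_def by blast
  let ?x = "\<lambda>v. (1 - s) * y v + s * z v"
  have lin: "lin_form V a ?x + b = (1 - s) * (lin_form V a y + b) + s * (lin_form V a z + b)" for a b
    using coord_affine_convex_comb[of V "\<lambda>z. lin_form V a z + b"] coord_affine_real by fast
  have cone: "soc_sat V C ?x" if "soc_sat V C y" "soc_sat V C z" for C
  proof -
    let ?n = "\<lambda>x i. lin_form V (fst (soc_rows C ! i)) x + snd (soc_rows C ! i)"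
    let ?I = "{..<length (soc_rows C)}"
    have "L2_set (?n ?x) ?I \<le> L2_set (\<lambda>i. (1 - s) * ?n y i) ?I + L2_set (\<lambda>i. s * ?n z i) ?I"
      unfolding lin by (rule L2_set_triangle_ineq)
    also have "\<dots> = (1 - s) * L2_set (?n y) ?I + s * L2_set (?n z) ?I"
      using assms(4) by (simp add: L2_set_right_distrib)
    also have "\<dots> \<le> lin_form V (soc_c C) ?x + soc_d C"
      unfolding lin using that assms(4) unfolding soc_sat_def
      by (intro add_mono mult_left_mono) auto
    finally show ?thesis unfolding soc_sat_def .
  qed
  have eq: "lin_form V a ?x = b" if "lin_form V a y = b" "lin_form V a z = b" for a b
    using lin[of a 0] that by (simp add: algebra_simps)
  note yz = assms(2,3)[unfolded p socp_feasible_def]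
  show ?thesis
    unfolding p socp_feasible_def
  proof (intro conjI ballI)
    fix C assume "C \<in> set (cones p)"
    then show "soc_sat V C ?x" using cone yz by blast
  next
    fix e assume "e \<in> set (eqs p)"
    then show "case e of (a, b) \<Rightarrow> lin_form V a ?x = b"
      using eq[of "fst e" "snd e"] yz by (auto simp: split_beta)
  qed
qed

lemma soc_describable_Inl:
  fixes V :: "'v set" and W :: "'w set"
  assumes W: "finite W" and F: "soc_describable V F"
  shows "soc_describable (V <+> W) (\<lambda>y. F (\<lambda>v. y (Inl v)))"
proof -
  obtain p where p: "\<And>z. F z \<longleftrightarrow> socp_feasible V p z" and V: "finite V"
    using F unfolding soc_describable_def by blast
  have aff: "coord_affine (V <+> W) (\<lambda>y. lin_form V a (\<lambda>v. y (Inl v)) + b)" for a b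
    using coord_affine_real by (intro coord_affine_Inl[OF V W]) fast
  have "soc_describable (V <+> W) (\<lambda>y. soc_sat V C (\<lambda>v. y (Inl v)))" for C
  proof -
    define gs where "gs = map (\<lambda>r (y :: 'v + 'w \<Rightarrow> real). lin_form V (fst r) (\<lambda>v. y (Inl v)) + snd r) (soc_rows C)"
    have "soc_describable (V <+> W) (\<lambda>y. sqrt (\<Sum>g\<leftarrow>gs. (g y)\<^sup>2)
        \<le> lin_form V (soc_c C) (\<lambda>v. y (Inl v)) + soc_d C)"
      using V W aff by (intro soc_describable_list) (auto simp: gs_def)
    then show ?thesis
      unfolding soc_sat_def L2_set_def by (simp add: gs_def o_def sum_list_sum_nth atLeast0LessThan)
  qed
  moreover have "soc_describable (V <+> W) (\<lambda>y. lin_form V a (\<lambda>v. y (Inl v)) = b)" for a b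
    using aff[of a 0] V W by (intro soc_describable_eq) (auto intro: coord_affine_const)
  ultimately show ?thesis
    unfolding p socp_feasible_def using V W
    by (intro soc_describable_conj soc_describable_Ball) (auto simp: split_beta)
qed

text \<open>The normal form of a convex quadratic function on a set of coordinate vectors: a finite sum of
  squares of affine functions plus an affine function.  Unlike a quadratic form that is only known
  to be convex along \<open>D\<close>, it shows convexity everywhere and translates into a cone constraint.\<close>

definition sum_squares_on :: "'v set \<Rightarrow> ('v \<Rightarrow> real) set \<Rightarrow> (('v \<Rightarrow> real) \<Rightarrow> real) \<Rightarrow> bool" where
  "sum_squares_on V D \<phi> \<longleftrightarrow> (\<exists>gs k. (\<forall>g\<in>set gs. coord_affine V g) \<and> coord_affine V k \<and>
     (\<forall>z\<in>D. \<phi> z = (\<Sum>g\<leftarrow>gs. (g z)\<^sup>2) + k z))"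

lemma sum_squares_on_zero: "sum_squares_on V D (\<lambda>z. 0)"
  unfolding sum_squares_on_def
  by (rule exI[of _ "[]"], rule exI[of _ "\<lambda>z. 0"]) (simp add: coord_affine_const)

lemma sum_squares_on_add:
  assumes "sum_squares_on V D \<phi>" "sum_squares_on V D \<psi>"
  shows "sum_squares_on V D (\<lambda>z. \<phi> z + \<psi> z)"
proof -
  obtain gs k gs' k' where
    "\<forall>g\<in>set gs. coord_affine V g" "coord_affine V k" "\<forall>z\<in>D. \<phi> z = (\<Sum>g\<leftarrow>gs. (g z)\<^sup>2) + k z"
    "\<forall>g\<in>set gs'. coord_affine V g" "coord_affine V k'" "\<forall>z\<in>D. \<psi> z = (\<Sum>g\<leftarrow>gs'. (g z)\<^sup>2) + k' z"
    using assms unfolding sum_squares_on_def by blast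
  then show ?thesis
    unfolding sum_squares_on_def
    by (intro exI[of _ "gs @ gs'"] exI[of _ "\<lambda>z. k z + k' z"]) (auto intro: coord_affine_add)
qed

lemma sum_squares_on_sum:
  "(\<And>i. i \<in> I \<Longrightarrow> sum_squares_on V D (\<phi> i)) \<Longrightarrow> sum_squares_on V D (\<lambda>z. \<Sum>i\<in>I. \<phi> i z)"
  by (induction I rule: infinite_finite_induct) (auto intro: sum_squares_on_zero sum_squares_on_add)

lemma square_convex_comb:
  fixes p q :: real
  assumes "s \<in> {0..1}"
  shows "((1 - s) * p + s * q)\<^sup>2 \<le> (1 - s) * p\<^sup>2 + s * q\<^sup>2"
proof -
  have "0 \<le> s * (1 - s) * (p - q)\<^sup>2" using assms by simp
  then show ?thesis by (simp add: power2_eq_square algebra_simps)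
qed

lemma sum_squares_quadratic:
  assumes "\<And>g. g \<in> set gs \<Longrightarrow> coord_affine V g"
  shows "\<exists>Q q q0. \<forall>z. (\<Sum>g\<leftarrow>gs. (g z)\<^sup>2) = (\<Sum>v\<in>V. \<Sum>w\<in>V. Q v w * z v * z w) + (\<Sum>v\<in>V. q v * z v) + q0"
  using assms
proof (induction gs)
  case Nil
  show ?case
    by (rule exI[of _ "\<lambda>v w. 0"], rule exI[of _ "\<lambda>v. 0"], rule exI[of _ 0]) simp
next
  case (Cons g gs)
  obtain Q q q0 where
    IH: "\<And>z. (\<Sum>g\<leftarrow>gs. (g z)\<^sup>2) = (\<Sum>v\<in>V. \<Sum>w\<in>V. Q v w * z v * z w) + (\<Sum>v\<in>V. q v * z v) + q0"
    using Cons.IH[OF Cons.prems] by auto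
  obtain a b where g: "\<And>z. g z = lin_form V a z + b"
    using Cons.prems[of g] unfolding coord_affine_real by auto
  have "(g z)\<^sup>2 = (\<Sum>v\<in>V. \<Sum>w\<in>V. (a v * a w) * z v * z w) + (\<Sum>v\<in>V. (2 * b * a v) * z v) + b\<^sup>2" for z
  proof -
    have "(lin_form V a z)\<^sup>2 = (\<Sum>v\<in>V. \<Sum>w\<in>V. (a v * a w) * z v * z w)"
      unfolding lin_form_def power2_eq_square sum_product by (intro sum.cong refl) (simp add: mult_ac)
    moreover have "2 * b * lin_form V a z = (\<Sum>v\<in>V. (2 * b * a v) * z v)"
      unfolding lin_form_def sum_distrib_left by (intro sum.cong refl) (simp add: mult_ac)
    moreover have "(g z)\<^sup>2 = (lin_form V a z)\<^sup>2 + 2 * b * lin_form V a z + b\<^sup>2"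
      by (simp add: g power2_eq_square algebra_simps)
    ultimately show ?thesis by simp
  qed
  then have expand: "(\<Sum>g\<leftarrow>g # gs. (g z)\<^sup>2) = (\<Sum>v\<in>V. \<Sum>w\<in>V. (a v * a w + Q v w) * z v * z w)
      + (\<Sum>v\<in>V. (2 * b * a v + q v) * z v) + (b\<^sup>2 + q0)" for z
    by (simp add: IH distrib_right sum.distrib)
  show ?case
    by (rule exI[of _ "\<lambda>v w. a v * a w + Q v w"], rule exI[of _ "\<lambda>v. 2 * b * a v + q v"],
        rule exI[of _ "b\<^sup>2 + q0"]) (rule allI, rule expand)
qed

lemma sum_squares_coord_convex_quadratic:
  assumes F: "soc_describable V F" and \<phi>: "sum_squares_on V {z. F z} \<phi>"
  shows "coord_convex_quadratic_on V {z. F z} \<phi>"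
proof -
  obtain gs k where gs: "\<And>g. g \<in> set gs \<Longrightarrow> coord_affine V g" and k: "coord_affine V k"
    and eq: "\<And>z. F z \<Longrightarrow> \<phi> z = (\<Sum>g\<leftarrow>gs. (g z)\<^sup>2) + k z"
    using \<phi> unfolding sum_squares_on_def by blast
  have convex: "F (\<lambda>v. (1 - s) * y v + s * z v) \<and>
      \<phi> (\<lambda>v. (1 - s) * y v + s * z v) \<le> (1 - s) * \<phi> y + s * \<phi> z"
    if yz: "F y" "F z" and s: "s \<in> {0..1}" for y z s
  proof -
    let ?x = "\<lambda>v. (1 - s) * y v + s * z v"
    have x: "F ?x" using soc_describable_convex[where F = F, OF F yz s] .
    have "(\<Sum>g\<leftarrow>gs. (g ?x)\<^sup>2) \<le> (\<Sum>g\<leftarrow>gs. (1 - s) * (g y)\<^sup>2 + s * (g z)\<^sup>2)"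
    proof (rule sum_list_mono)
      fix g assume "g \<in> set gs"
      from coord_affine_convex_comb[OF gs[OF this], of s y z] square_convex_comb[OF s, of "g y" "g z"]
      show "(g ?x)\<^sup>2 \<le> (1 - s) * (g y)\<^sup>2 + s * (g z)\<^sup>2" by simp
    qed
    also have "\<dots> = (1 - s) * (\<Sum>g\<leftarrow>gs. (g y)\<^sup>2) + s * (\<Sum>g\<leftarrow>gs. (g z)\<^sup>2)"
      by (simp add: sum_list_addf sum_list_const_mult)
    finally have sum: "(\<Sum>g\<leftarrow>gs. (g ?x)\<^sup>2) \<le> (1 - s) * (\<Sum>g\<leftarrow>gs. (g y)\<^sup>2) + s * (\<Sum>g\<leftarrow>gs. (g z)\<^sup>2)" .
    have "\<phi> ?x = (\<Sum>g\<leftarrow>gs. (g ?x)\<^sup>2) + k ?x"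
      by (rule eq[OF x])
    also have "\<dots> \<le> ((1 - s) * (\<Sum>g\<leftarrow>gs. (g y)\<^sup>2) + s * (\<Sum>g\<leftarrow>gs. (g z)\<^sup>2)) + ((1 - s) * k y + s * k z)"
      using sum by (rule add_mono) (rule eq_refl, rule coord_affine_convex_comb[OF k])
    also have "\<dots> = (1 - s) * \<phi> y + s * \<phi> z"
      unfolding eq[OF yz(1)] eq[OF yz(2)] distrib_left by linarith
    finally show ?thesis using x by (rule conjI[rotated])
  qed
  have "\<exists>Q q q0. \<forall>z. (\<Sum>g\<leftarrow>gs. (g z)\<^sup>2) = (\<Sum>v\<in>V. \<Sum>w\<in>V. Q v w * z v * z w) + (\<Sum>v\<in>V. q v * z v) + q0"
    by (rule sum_squares_quadratic) (rule gs)
  then obtain Q q q0 where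
    Q: "\<forall>z. (\<Sum>g\<leftarrow>gs. (g z)\<^sup>2) = (\<Sum>v\<in>V. \<Sum>w\<in>V. Q v w * z v * z w) + (\<Sum>v\<in>V. q v * z v) + q0"
    by (elim exE) (rule that)
  obtain a b where "\<And>z. k z = lin_form V a z + b"
    using k unfolding coord_affine_real by blast
  then have expand: "\<forall>z\<in>{z. F z}. \<phi> z = (\<Sum>v\<in>V. \<Sum>w\<in>V. Q v w * z v * z w) + (\<Sum>v\<in>V. (q v + a v) * z v) + (q0 + b)"
    by (simp add: eq Q lin_form_def distrib_right sum.distrib)
  have "\<exists>Q q q0. \<forall>z\<in>{z. F z}. \<phi> z = (\<Sum>v\<in>V. \<Sum>w\<in>V. Q v w * z v * z w) + (\<Sum>v\<in>V. q v * z v) + q0"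
    by (rule exI[of _ Q], rule exI[of _ "\<lambda>v. q v + a v"], rule exI[of _ "q0 + b"]) (rule expand)
  moreover have "\<forall>y\<in>{z. F z}. \<forall>z\<in>{z. F z}. \<forall>s\<in>{0..1}. (\<lambda>v. (1 - s) * y v + s * z v) \<in> {z. F z} \<and>
      \<phi> (\<lambda>v. (1 - s) * y v + s * z v) \<le> (1 - s) * \<phi> y + s * \<phi> z"
  proof (intro ballI)
    fix y z :: "'a \<Rightarrow> real" and s :: real
    assume "y \<in> {z. F z}" "z \<in> {z. F z}" "s \<in> {0..1}"
    then show "(\<lambda>v. (1 - s) * y v + s * z v) \<in> {z. F z} \<and>
        \<phi> (\<lambda>v. (1 - s) * y v + s * z v) \<le> (1 - s) * \<phi> y + s * \<phi> z"
      unfolding mem_Collect_eq by (rule convex[of y z s])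
  qed
  ultimately show ?thesis
    unfolding coord_convex_quadratic_on_def by (rule conjI[rotated])
qed

text \<open>A single auxiliary coordinate \<open>\<sigma>\<close> serves as the objective.  The constraint \<open>\<Sum>\<^sub>g g\<^sup>2 \<le> d\<close> with
  \<open>d = \<sigma> - k\<close> is equivalent to \<open>\<parallel>(d - 1, 2 g, \<dots>)\<parallel> \<le> d + 1\<close>, because
  \<open>(d + 1)\<^sup>2 - (d - 1)\<^sup>2 = 4 d\<close>.\<close>

lemma sum_squares_socp_representable:
  assumes F: "soc_describable V F" and \<phi>: "sum_squares_on V {z. F z} \<phi>"
  shows "socp_representable V F \<phi>"
proof -
  obtain gs k where gs: "\<And>g. g \<in> set gs \<Longrightarrow> coord_affine V g" and k: "coord_affine V k"
    and eq: "\<And>z. F z \<Longrightarrow> \<phi> z = (\<Sum>g\<leftarrow>gs. (g z)\<^sup>2) + k z"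
    using \<phi> unfolding sum_squares_on_def by blast
  have V: "finite V" using F by (simp add: soc_describable_def)
  define U where "U = V <+> {0::nat}"
  have U: "finite U" using V by (simp add: U_def)
  let ?z = "\<lambda>(y :: 'a + nat \<Rightarrow> real) v. y (Inl v)"
  have lift: "coord_affine U (\<lambda>y. g (?z y))" if "coord_affine V g" for g :: "_ \<Rightarrow> real"
    unfolding U_def by (rule coord_affine_Inl[OF V _ that]) simp
  have aux: "coord_affine U (\<lambda>y. y (Inr 0))"
    by (rule coord_affine_coord[OF U]) (simp add: U_def Plus_def)
  define gs' where "gs' = (\<lambda>y. y (Inr 0) - k (?z y) - 1) # map (\<lambda>g y. 2 * g (?z y)) gs"
  have gs': "coord_affine U g" if "g \<in> set gs'" for g
  proof -
    have "coord_affine U (\<lambda>y. y (Inr 0) - k (?z y) - 1)"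
      by (intro coord_affine_diff aux lift[OF k] coord_affine_const)
    moreover have "coord_affine U (\<lambda>y. 2 * g (?z y))" if "g \<in> set gs" for g
      using lift[OF gs[OF that]] by (rule coord_affine_mult_left)
    ultimately show ?thesis using that by (auto simp: gs'_def)
  qed
  have lifted: "soc_describable U (\<lambda>y. F (?z y))"
    using soc_describable_Inl[OF _ F, of "{0::nat}"] by (simp add: U_def)
  have rhs: "coord_affine U (\<lambda>y. y (Inr 0) - k (?z y) + 1)"
    by (intro coord_affine_add coord_affine_diff aux lift[OF k] coord_affine_const)
  have "soc_describable U (\<lambda>y. F (?z y) \<and> sqrt (\<Sum>g\<leftarrow>gs'. (g y)\<^sup>2) \<le> y (Inr 0) - k (?z y) + 1)"
    by (rule soc_describable_conj[OF lifted soc_describable_list[OF U gs' rhs]])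
  then obtain p where p: "\<And>y. socp_feasible U p y \<longleftrightarrow>
      F (?z y) \<and> sqrt (\<Sum>g\<leftarrow>gs'. (g y)\<^sup>2) \<le> y (Inr 0) - k (?z y) + 1"
    unfolding soc_describable_def by metis
  have cone: "sqrt (\<Sum>g\<leftarrow>gs'. (g (case_sum z w))\<^sup>2) \<le> w 0 - k z + 1 \<longleftrightarrow> (\<Sum>g\<leftarrow>gs. (g z)\<^sup>2) + k z \<le> w 0" for z w
  proof -
    let ?s = "\<Sum>g\<leftarrow>gs. (g z)\<^sup>2" and ?d = "w 0 - k z"
    have s0: "0 \<le> ?s" by (intro sum_list_nonneg) auto
    have "(\<Sum>g\<leftarrow>gs'. (g (case_sum z w))\<^sup>2) = (?d - 1)\<^sup>2 + 4 * ?s"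
      by (simp add: gs'_def o_def power_mult_distrib sum_list_const_mult)
    moreover have "sqrt ((?d - 1)\<^sup>2 + 4 * ?s) \<le> ?d + 1 \<longleftrightarrow> ?s \<le> ?d"
    proof -
      have "(d - 1)\<^sup>2 + 4 * e \<le> (d + 1)\<^sup>2 \<longleftrightarrow> e \<le> d" for d e :: real
        by (rule iffI) (simp_all add: power2_eq_square algebra_simps)
      moreover have "0 \<le> ?d + 1" if "?s \<le> ?d" using that s0 by linarith
      ultimately show ?thesis using s0 by (subst sqrt_le_iff_square) auto
    qed
    ultimately show ?thesis by auto
  qed
  define p' where "p' = p\<lparr>objective := case_sum (\<lambda>_. 0) (\<lambda>_. 1)\<rparr>"
  have feas: "socp_feasible U p' (case_sum z w) \<longleftrightarrow> F z \<and> (\<Sum>g\<leftarrow>gs. (g z)\<^sup>2) + k z \<le> w 0" for z w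
    using p[of "case_sum z w"] cone[of z w] by (simp add: socp_feasible_def p'_def)
  have obj: "lin_form U (objective p') (case_sum z w) = w 0" for z w
    using V by (simp add: U_def p'_def lin_form_def sum.Plus)
  have "F z \<and> \<phi> z \<le> \<tau> \<longleftrightarrow> (\<exists>w. socp_feasible U p' (case_sum z w) \<and>
      lin_form U (objective p') (case_sum z w) \<le> \<tau>)" for z \<tau>
    unfolding feas obj by (auto simp: eq intro: exI[of _ "\<lambda>_. \<tau>"])
  then show ?thesis
    unfolding socp_representable_def U_def using V by blast
qed

section \<open>Convex quadratic functions as sums of squares\<close>

text \<open>Lagrange's completion of squares, one coordinate at a time.  A new coordinate \<open>x\<close> with
  \<open>d = Q x x > 0\<close> contributes the square \<open>(d z\<^sub>x + s)\<^sup>2 / d\<close>, where \<open>s\<close> collects the mixed terms, and leaves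
  the Schur complement \<open>R\<close>; this is again semidefinite since \<open>z\<^sub>x = - s / d\<close> makes the square vanish.
  If \<open>d = 0\<close>, then semidefiniteness forces \<open>s = 0\<close>, and by \<open>x / 0 = 0\<close> the same formulas remain valid.\<close>

lemma psd_form_sum_squares:
  fixes Q :: "'v \<Rightarrow> 'v \<Rightarrow> real"
  assumes "finite V" "\<And>v w. Q v w = Q w v"
    and "\<And>z. 0 \<le> (\<Sum>v\<in>V. \<Sum>w\<in>V. Q v w * z v * z w)"
  shows "\<exists>as. \<forall>z. (\<Sum>v\<in>V. \<Sum>w\<in>V. Q v w * z v * z w) = (\<Sum>a\<leftarrow>as. (\<Sum>v\<in>V. a v * z v)\<^sup>2)"
  using assms
proof (induction V arbitrary: Q rule: finite_induct)
  case empty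
  show ?case by (rule exI[of _ "[]"]) simp
next
  case (insert x V)
  define s where "s z = (\<Sum>w\<in>V. Q x w * z w)" for z
  define form where "form R z = (\<Sum>v\<in>V. \<Sum>w\<in>V. R v w * z v * z w)" for R :: "'v \<Rightarrow> 'v \<Rightarrow> real" and z
  define d where "d = Q x x"
  have split: "(\<Sum>v\<in>insert x V. \<Sum>w\<in>insert x V. Q v w * z v * z w) = d * (z x)\<^sup>2 + 2 * z x * s z + form Q z" for z
  proof -
    have "(\<Sum>v\<in>V. Q v x * z v * z x) = z x * s z"
      unfolding s_def sum_distrib_left by (intro sum.cong) (simp_all add: insert.prems(1)[of _ x] mult_ac)
    moreover have "(\<Sum>w\<in>V. Q x w * z x * z w) = z x * s z"
      unfolding s_def sum_distrib_left by (intro sum.cong) (simp_all add: mult_ac)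
    ultimately show ?thesis
      using insert.hyps by (simp add: sum.distrib form_def d_def power2_eq_square)
  qed
  have s_upd: "s (z(x := e)) = s z" and form_upd: "form R (z(x := e)) = form R z" for z e R
    unfolding s_def form_def using insert.hyps by (auto intro!: sum.cong)
  have nonneg: "0 \<le> d * e\<^sup>2 + 2 * e * s z + form Q z" for e z
    using insert.prems(2)[of "z(x := e)"] unfolding split s_upd form_upd by simp
  have d: "0 \<le> d"
    using nonneg[of 1 "\<lambda>_. 0"] by (simp add: s_def form_def)
  have s0: "s z = 0" if "d = 0" for z
  proof (rule ccontr)
    assume "s z \<noteq> 0"
    then show False
      using nonneg[of "- (form Q z + 1) / (2 * s z)" z] that by (simp add: field_simps)
  qed
  define R where "R v w = Q v w - Q x v * Q x w / d" for v w
  have form_R: "form R z = form Q z - (s z)\<^sup>2 / d" for z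
  proof -
    have "(s z)\<^sup>2 / d = (\<Sum>v\<in>V. \<Sum>w\<in>V. Q x v * Q x w / d * z v * z w)"
      by (simp add: s_def power2_eq_square sum_product sum_divide_distrib mult_ac)
    then show ?thesis
      by (simp add: form_def R_def sum_subtractf[symmetric] left_diff_distrib)
  qed
  have "0 \<le> form R z" for z
  proof (cases "d = 0")
    case True
    then show ?thesis using nonneg[of 0 z] by (simp add: form_R)
  next
    case False
    then show ?thesis using nonneg[of "- s z / d" z]
      by (simp add: form_R power2_eq_square)
  qed
  moreover have "R v w = R w v" for v w
    by (simp add: R_def insert.prems(1)[of v w] mult.commute)
  ultimately obtain as where as: "\<And>z. form R z = (\<Sum>a\<leftarrow>as. (\<Sum>v\<in>V. a v * z v)\<^sup>2)"
    using insert.IH[of R] unfolding form_def by blast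
  define a0 where "a0 = (\<lambda>v. Q x v / sqrt d)"
  define as' where "as' = a0 # map (\<lambda>a. a(x := 0)) as"
  have head: "(\<Sum>v\<in>insert x V. a0 v * z v)\<^sup>2 = d * (z x)\<^sup>2 + 2 * z x * s z + (s z)\<^sup>2 / d" for z
  proof -
    have "(\<Sum>v\<in>insert x V. a0 v * z v) = (d * z x + s z) / sqrt d"
      using insert.hyps by (simp add: a0_def d_def s_def add_divide_distrib sum_divide_distrib)
    then have "(\<Sum>v\<in>insert x V. a0 v * z v)\<^sup>2 = (d * z x + s z)\<^sup>2 / d"
      using d by (simp add: power_divide)
    then show ?thesis
      using s0[of z] by (cases "d = 0") (simp_all add: power2_eq_square field_simps)
  qed
  have tail: "(\<Sum>v\<in>insert x V. (a(x := 0)) v * z v) = (\<Sum>v\<in>V. a v * z v)" for a z :: "'v \<Rightarrow> real"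
    using insert.hyps by (auto intro!: sum.cong)
  have "(\<Sum>v\<in>insert x V. \<Sum>w\<in>insert x V. Q v w * z v * z w) = (\<Sum>a\<leftarrow>as'. (\<Sum>v\<in>insert x V. a v * z v)\<^sup>2)" for z
    unfolding split as'_def list.map sum_list.Cons head
    by (simp add: o_def tail as[symmetric] form_R del: fun_upd_apply)
  then show ?case by blast
qed

text \<open>The form need not be given by a symmetric map, so its symmetric part \<open>R\<close> is taken first.\<close>

lemma psd_form_sum_squares_euclidean:
  fixes Q :: "'a::euclidean_space \<Rightarrow> 'a"
  assumes Q: "linear Q" and psd: "\<And>w. 0 \<le> w \<bullet> Q w"
  shows "\<exists>as. \<forall>w. w \<bullet> Q w = (\<Sum>a\<leftarrow>as. (a \<bullet> w)\<^sup>2)"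
proof -
  define R where "R b c = (b \<bullet> Q c + c \<bullet> Q b) / 2" for b c
  have comb: "(\<Sum>b\<in>Basis. \<Sum>c\<in>Basis. R b c * z b * z c) = w \<bullet> Q w"
    if w: "w = (\<Sum>b\<in>Basis. z b *\<^sub>R b)" for z w
  proof -
    have 1: "w \<bullet> Q w = (\<Sum>b\<in>Basis. \<Sum>c\<in>Basis. (c \<bullet> Q b) * z b * z c)"
      unfolding w by (simp add: linear_sum[OF Q] linear_cmul[OF Q] inner_sum_left inner_sum_right
          sum_distrib_left mult_ac)
    have 2: "w \<bullet> Q w = (\<Sum>b\<in>Basis. \<Sum>c\<in>Basis. (b \<bullet> Q c) * z b * z c)"
      unfolding 1 by (subst sum.swap) (simp add: mult_ac)
    have "2 * (R b c * z b * z c) = (b \<bullet> Q c) * z b * z c + (c \<bullet> Q b) * z b * z c" for b c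
      by (simp add: R_def field_simps)
    then have "2 * (\<Sum>b\<in>Basis. \<Sum>c\<in>Basis. R b c * z b * z c)
        = (\<Sum>b\<in>Basis. \<Sum>c\<in>Basis. (b \<bullet> Q c) * z b * z c) + (\<Sum>b\<in>Basis. \<Sum>c\<in>Basis. (c \<bullet> Q b) * z b * z c)"
      by (simp only: sum_distrib_left sum.distrib[symmetric])
    also have "\<dots> = 2 * (w \<bullet> Q w)"
      using 1 2 by simp
    finally
    show ?thesis by simp
  qed
  obtain as where as: "\<And>z. (\<Sum>b\<in>Basis. \<Sum>c\<in>Basis. R b c * z b * z c)
      = (\<Sum>a\<leftarrow>as. (\<Sum>b\<in>Basis. a b * z b)\<^sup>2)"
    using psd_form_sum_squares[of "Basis :: 'a set" R] psd comb[OF refl] by (auto simp: R_def add.commute)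
  have "w \<bullet> Q w = (\<Sum>a\<leftarrow>map (\<lambda>a. \<Sum>b\<in>Basis. a b *\<^sub>R b) as. (a \<bullet> w)\<^sup>2)" for w
  proof -
    have "w \<bullet> Q w = (\<Sum>a\<leftarrow>as. (\<Sum>b\<in>Basis. a b * (w \<bullet> b))\<^sup>2)"
      unfolding as[symmetric] by (rule comb[symmetric]) (simp add: euclidean_representation)
    then show ?thesis by (simp add: o_def inner_sum_left inner_commute[of w])
  qed
  then show ?thesis by blast
qed

text \<open>Around a relative interior point \<open>d\<close> of \<open>D\<close>, convexity along segments in the direction space \<open>L\<close> of
  the affine hull of \<open>D\<close> shows that the quadratic form is nonnegative on \<open>L\<close>, though perhaps not
  elsewhere.  Composing it with a projection \<open>p\<close> onto \<open>L\<close> makes it semidefinite on the whole space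
  without changing it at the vectors \<open>z - d\<close> for \<open>z \<in> D\<close>.\<close>

lemma convex_quadratic_sum_squares:
  fixes \<phi> :: "'a::euclidean_space \<Rightarrow> real"
  assumes "convex_quadratic_on D \<phi>"
  shows "\<exists>as d q q0. \<forall>z\<in>D. \<phi> z = (\<Sum>a\<leftarrow>as. (a \<bullet> (z - d))\<^sup>2) + q \<bullet> z + q0"
proof (cases "D = {}")
  case False
  obtain Q q q0 where conv: "convex_on D \<phi>" and Q: "linear Q"
    and \<phi>: "\<And>z. z \<in> D \<Longrightarrow> \<phi> z = z \<bullet> Q z + q \<bullet> z + q0"
    using assms unfolding convex_quadratic_on_def by blast
  have "convex D" using conv by (simp add: convex_on_def)
  then obtain d e where d: "d \<in> D" and e: "e > 0" "ball d e \<inter> affine hull D \<subseteq> D"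
    using False rel_interior_eq_empty[of D] mem_rel_interior_ball by blast
  define L where "L = span ((\<lambda>x. - d + x) ` D)"
  have L: "x - d \<in> L" if "x \<in> D" for x
    unfolding L_def using that by (intro span_base) auto
  have hull: "affine hull D = (\<lambda>x. d + x) ` L"
    unfolding L_def using d by (intro affine_hull_span_gen hull_inc)
  note Qs = linear_add[OF Q] linear_diff[OF Q] linear_cmul[OF Q]
  have psd: "0 \<le> w \<bullet> Q w" if w: "w \<in> L" for w
  proof -
    \<comment> \<open>a step short enough to stay in \<open>D\<close> in both directions\<close>
    define s where "s = e / (2 * (norm w + 1))"
    have s: "s > 0" using e(1) by (simp add: s_def add_nonneg_pos)
    have "norm (s *\<^sub>R w) < e"
    proof -
      have "norm (s *\<^sub>R w) = s * norm w" using s by simp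
      also have "\<dots> = e * (norm w / (2 * (norm w + 1)))" by (simp add: s_def)
      also have "\<dots> < e * 1"
        using e(1) by (intro mult_strict_left_mono) (auto simp: divide_less_eq add_nonneg_pos)
      finally show ?thesis by simp
    qed
    moreover have "s *\<^sub>R w \<in> L" "- s *\<^sub>R w \<in> L"
      using w unfolding L_def by (auto intro: span_scale span_neg)
    ultimately have mem: "d + s *\<^sub>R w \<in> D" "d + (- s) *\<^sub>R w \<in> D"
      using e(2) unfolding hull by (auto simp: dist_norm subset_iff)
    have "\<phi> ((1/2) *\<^sub>R (d + s *\<^sub>R w) + (1/2) *\<^sub>R (d + (- s) *\<^sub>R w))
        \<le> (1/2) * \<phi> (d + s *\<^sub>R w) + (1/2) * \<phi> (d + (- s) *\<^sub>R w)"
      using conv[unfolded convex_on_def, THEN conjunct2, rule_format, OF mem, of "1/2" "1/2"] by simp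
    moreover have "(1/2) *\<^sub>R (d + s *\<^sub>R w) + (1/2) *\<^sub>R (d + (- s) *\<^sub>R w) = d"
      by (simp add: scaleR_right_distrib scaleR_right_diff_distrib scaleR_left_distrib[symmetric])
    \<comment> \<open>the second difference of \<open>\<phi>\<close> at \<open>d\<close>; the affine part cancels\<close>
    ultimately have "0 \<le> s * s * (w \<bullet> Q w)"
      using d mem by (simp add: \<phi> Qs inner_left_distrib inner_right_distrib inner_diff_left inner_diff_right
          algebra_simps add_divide_distrib diff_divide_distrib)
    then show ?thesis using mult_pos_pos[OF s s] by (auto simp: zero_le_mult_iff)
  qed
  obtain p where p: "range p \<subseteq> L" "linear p" "\<And>x. x \<in> L \<Longrightarrow> p x = x"
    using linear_exists_left_inverse_on[of id L] unfolding L_def by (auto simp: linear_id)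
  have "linear (\<lambda>w. adjoint p (Q (p w)))"
    using linear_compose[OF linear_compose[OF p(2) Q] adjoint_linear[OF p(2)]] by (simp add: o_def)
  moreover have form: "w \<bullet> adjoint p (Q (p w)) = p w \<bullet> Q (p w)" for w
    by (simp add: adjoint_works[OF p(2)])
  moreover have "0 \<le> p w \<bullet> Q (p w)" for w
    using p(1) by (intro psd) auto
  ultimately obtain as where as: "\<And>w. p w \<bullet> Q (p w) = (\<Sum>a\<leftarrow>as. (a \<bullet> w)\<^sup>2)"
    using psd_form_sum_squares_euclidean[of "\<lambda>w. adjoint p (Q (p w))"] by auto
  have "\<phi> z = (\<Sum>a\<leftarrow>as. (a \<bullet> (z - d))\<^sup>2) + (Q d + adjoint Q d + q) \<bullet> z + (q0 - d \<bullet> Q d)" if z: "z \<in> D" for z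
  proof -
    have "(z - d) \<bullet> Q (z - d) = (\<Sum>a\<leftarrow>as. (a \<bullet> (z - d))\<^sup>2)"
      using as[of "z - d"] p(3)[OF L[OF z]] by simp
    moreover have "adjoint Q d \<bullet> z = d \<bullet> Q z"
      by (metis adjoint_works[OF Q] inner_commute)
    ultimately show ?thesis
      using z by (simp add: \<phi> Qs inner_diff_left inner_diff_right inner_left_distrib inner_commute algebra_simps)
  qed
  then show ?thesis by blast
qed simp

lemma sum_squares_on_convex_quadratic:
  fixes g :: "('v \<Rightarrow> real) \<Rightarrow> 'a::euclidean_space"
  assumes "convex_quadratic_on D' \<phi>" "coord_affine V g" "\<And>z. z \<in> D \<Longrightarrow> g z \<in> D'"
  shows "sum_squares_on V D (\<lambda>z. \<phi> (g z))"
proof -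
  obtain as d q q0 where "\<And>z. z \<in> D' \<Longrightarrow> \<phi> z = (\<Sum>a\<leftarrow>as. (a \<bullet> (z - d))\<^sup>2) + q \<bullet> z + q0"
    using convex_quadratic_sum_squares[OF assms(1)] by blast
  then show ?thesis
    unfolding sum_squares_on_def using assms(2,3)
    by (intro exI[of _ "map (\<lambda>a z. a \<bullet> (g z - d)) as"] exI[of _ "\<lambda>z. q \<bullet> g z + q0"])
      (auto simp: o_def add.assoc intro!: coord_affine_intros)
qed

section \<open>The reformulated problem as a second-order cone program\<close>

lemma finite_mpc_vars: "finite (mpc_vars N :: ('x::finite, 'u::finite) mpc_var set)"
proof -
  have "mpc_vars N = (\<lambda>(k, i). U_var k i) ` ({..<N} \<times> UNIV) \<union> (\<lambda>(k, i). X_var k i) ` ({..N} \<times> UNIV)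
      \<union> range C_var \<union> {R_var, Lam_var :: ('x, 'u) mpc_var} \<union> range T_var"
    unfolding mpc_vars_def by auto
  then show ?thesis by simp
qed

lemma coord_affine_mpc:
  fixes N :: nat
  defines "V \<equiv> mpc_vars N :: ('x::finite, 'u::finite) mpc_var set"
  shows "k < N \<Longrightarrow> coord_affine V (\<lambda>z. u_of z k)" "k \<le> N \<Longrightarrow> coord_affine V (\<lambda>z. x_of z k)"
    "coord_affine V c_of" "coord_affine V t_of"
    "coord_affine V (\<lambda>z. z R_var)" "coord_affine V (\<lambda>z. z Lam_var)"
  unfolding u_of_def x_of_def c_of_def[abs_def] t_of_def[abs_def] V_def
  by (intro coord_affine_vec coord_affine_coord finite_mpc_vars; auto simp: mpc_vars_def)+

lemma soc_describable_conic_constraints: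
  fixes A :: "real^'nx^'nx" and B :: "real^'nu^'nx" and K :: "real^'nx^'nu"
  shows "soc_describable (mpc_vars N :: ('nx, 'nu) mpc_var set)
    (\<lambda>z. conic_constraints N A B K E f G h P Ph Mh S \<pi> \<alpha> x_init
        (u_of z) (x_of z) (c_of z) (z R_var) (z Lam_var) (t_of z))"
proof -
  have All_Ball: "(\<forall>i. F i) \<longleftrightarrow> (\<forall>i\<in>UNIV. F i)" "(\<forall>k<N. H k) \<longleftrightarrow> (\<forall>k\<in>{..<N}. H k)"
    for F :: "'i \<Rightarrow> bool" and H by auto
  show ?thesis
    unfolding conic_constraints_def less_eq_vec_def qcone_def mem_Collect_eq prod.case All_Ball(2)
    unfolding All_Ball(1)
    by (intro soc_describable_conj soc_describable_Ball soc_describable_norm soc_describable_eq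
        soc_describable_le coord_affine_intros coord_affine_mpc finite_mpc_vars) auto
qed

text \<open>Only \<open>x\<^sub>1, \<dots>, x\<^sub>N\<^sub>-\<^sub>1\<close> are constrained to \<open>\<X>\<close> explicitly.  The last state inherits membership from the
  ellipsoid, which the conic constraints place inside \<open>\<X>\<close> even if it degenerates to the point \<open>c\<close>
  for \<open>r = 0\<close>.\<close>

lemma conic_constraints_state_input:
  fixes A Ph :: "real^'nx^'nx"
  assumes "conic_constraints N A B K E f G h P Ph Mh S \<pi> \<alpha> x_init u x c r lam t"
    and x_init: "x_init \<in> halfspaces E f" and Ph: "invertible Ph"
  shows "k \<le> N \<Longrightarrow> x k \<in> halfspaces E f" "k < N \<Longrightarrow> u k \<in> halfspaces G h"
proof -
  note * = assms(1)[unfolded conic_constraints_def]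
  have norm: "norm (Ph *v (x N - c)) \<le> r" using * by blast
  then have "0 \<le> r" by (rule order_trans[OF norm_ge_zero])
  then have "E *v x N \<le> f"
    using ellipsoid_in_halfspaces_iff[OF Ph, of r c E f] * norm by blast
  then show "x k \<in> halfspaces E f" if "k \<le> N"
    using * that x_init by (cases "k = 0"; cases "k = N") (auto simp: halfspaces_def)
  show "u k \<in> halfspaces G h" if "k < N"
    using * that by (auto simp: halfspaces_def)
qed

theorem mainTheorem5:
  fixes A :: "real^'nx^'nx" and B :: "real^'nu^'nx" and K :: "real^'nx^'nu"
    and E :: "real^'nx^'n" and f :: "real^'n" and G :: "real^'nu^'m" and h :: "real^'m"
    and P Ph M Mh S :: "real^'nx^'nx" and \<pi> \<alpha> :: "real^'nx"
    and x_init :: "real^'nx" and N :: nat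
    and l :: "(real^'nx) \<times> (real^'nu) \<Rightarrow> real" and \<psi> :: "real^'nx \<Rightarrow> real"
  assumes N: "N \<ge> 1"
    and P: "pos_def P"
    and x_init: "x_init \<in> halfspaces E f"
    and stable: "asymptotically_stable (A + B ** K)"
    and S: "invertible S"
    and S_P: "transpose S ** P ** S = diag_matrix \<pi>"
    and S_A: "transpose S ** transpose (A + B ** K) ** P ** (A + B ** K) ** S = diag_matrix \<alpha>"
    and M: "M = transpose (A + B ** K - mat 1) ** P ** (A + B ** K - mat 1)"
    and Ph: "is_psd_sqrt Ph P"
    and Mh: "is_psd_sqrt Mh M"
  shows
    "(\<forall>u x c r.
        mpc_feasible N A B K E f G h P x_init u x c r \<longleftrightarrow>
        (\<exists>lam t. conic_feasible N A B K E f G h P Ph Mh S \<pi> \<alpha> x_init u x c r lam t)) \<and>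
     (let V = (mpc_vars N :: ('nx, 'nu) mpc_var set);
          feas = (\<lambda>z :: ('nx, 'nu) mpc_var \<Rightarrow> real.
            conic_constraints N A B K E f G h P Ph Mh S \<pi> \<alpha> x_init
              (u_of z) (x_of z) (c_of z) (z R_var) (z Lam_var) (t_of z));
          cost = (\<lambda>z :: ('nx, 'nu) mpc_var \<Rightarrow> real. mpc_cost N l \<psi> (u_of z) (x_of z))
      in convex_quadratic_on (halfspaces E f \<times> halfspaces G h) l \<and>
         convex_quadratic_on (halfspaces E f) \<psi> \<longrightarrow>
           soc_describable V feas \<and>
           coord_convex_quadratic_on V {z. feas z} cost \<and>
           socp_representable V feas cost)"
proof (intro conjI allI)
  fix u x c r
  show "mpc_feasible N A B K E f G h P x_init u x c r \<longleftrightarrow>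
      (\<exists>lam t. conic_feasible N A B K E f G h P Ph Mh S \<pi> \<alpha> x_init u x c r lam t)"
    by (rule mpc_feasible_iff_conic_feasible[OF P S S_P S_A M Ph Mh])
next
  define V where "V = (mpc_vars N :: ('nx, 'nu) mpc_var set)"
  define feas where "feas = (\<lambda>z :: ('nx, 'nu) mpc_var \<Rightarrow> real.
    conic_constraints N A B K E f G h P Ph Mh S \<pi> \<alpha> x_init
      (u_of z) (x_of z) (c_of z) (z R_var) (z Lam_var) (t_of z))"
  define cost where "cost = (\<lambda>z :: ('nx, 'nu) mpc_var \<Rightarrow> real. mpc_cost N l \<psi> (u_of z) (x_of z))"
  have F: "soc_describable V feas"
    unfolding V_def feas_def by (rule soc_describable_conic_constraints)
  have "soc_describable V feas \<and> coord_convex_quadratic_on V {z. feas z} cost \<and> socp_representable V feas cost"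
    if l: "convex_quadratic_on (halfspaces E f \<times> halfspaces G h) l"
      and \<psi>: "convex_quadratic_on (halfspaces E f) \<psi>"
  proof -
    have x: "x_of z k \<in> halfspaces E f" if "feas z" "k \<le> N" for z k
      using conic_constraints_state_input(1)[OF _ x_init psd_sqrt_invertible[OF Ph P]] that
      unfolding feas_def by blast
    have u: "u_of z k \<in> halfspaces G h" if "feas z" "k < N" for z k
      using conic_constraints_state_input(2)[OF _ x_init psd_sqrt_invertible[OF Ph P]] that
      unfolding feas_def by blast
    have "sum_squares_on V {z. feas z} (\<lambda>z. l (x_of z k, u_of z k))" if "k < N" for k
      using that x u unfolding V_def
      by (intro sum_squares_on_convex_quadratic[OF l] coord_affine_Pair coord_affine_mpc) auto
    moreover have "sum_squares_on V {z. feas z} (\<lambda>z. \<psi> (x_of z N))"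
      using x unfolding V_def
      by (intro sum_squares_on_convex_quadratic[OF \<psi>] coord_affine_mpc) auto
    ultimately have "sum_squares_on V {z. feas z} cost"
      unfolding cost_def mpc_cost_def by (intro sum_squares_on_add sum_squares_on_sum) auto
    then show ?thesis
      using F sum_squares_coord_convex_quadratic[OF F] sum_squares_socp_representable[OF F] by blast
  qed
  then show "let V = (mpc_vars N :: ('nx, 'nu) mpc_var set);
      feas = (\<lambda>z :: ('nx, 'nu) mpc_var \<Rightarrow> real.
        conic_constraints N A B K E f G h P Ph Mh S \<pi> \<alpha> x_init
          (u_of z) (x_of z) (c_of z) (z R_var) (z Lam_var) (t_of z));
      cost = (\<lambda>z :: ('nx, 'nu) mpc_var \<Rightarrow> real. mpc_cost N l \<psi> (u_of z) (x_of z))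
    in convex_quadratic_on (halfspaces E f \<times> halfspaces G h) l \<and>
       convex_quadratic_on (halfspaces E f) \<psi> \<longrightarrow>
         soc_describable V feas \<and>
         coord_convex_quadratic_on V {z. feas z} cost \<and>
         socp_representable V feas cost"
    unfolding Let_def V_def feas_def cost_def by blast
qed

end
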